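(* Let $n\ge 1$ and let $q$ be the transpose top with random measure on $S_n$. For every $c\ge 0$ and every integer $t\ge n(\log n+c)$ we have $d_2(q^{(t)},u)\le \sqrt{2}\,e^{-c}$, and for every real $t\ge n(\log n+c)$ we have $d_2(h_{q,t},u)\le\sqrt{2}\,e^{-c}$.
   Context: For a probability measure $q$ on a finite group $G$, $q^{(t)}$ denotes the $t$-fold convolution power of $q$ (the law of $\xi_1\cdots\xi_t$ with $\xi_i$ i.i.d. of law $q$), $u\equiv 1/|G|$ is the uniform measure, and for a probability measure $p$ on $G$, $d_2(p,u)=\big(|G|\sum_{x\in G}|p(x)-u(x)|^2\big)^{1/2}$. The continuous time law is $h_{q,t}=e^{-t}\sum_{k\ge 0}\frac{t^k}{k!}q^{(k)}$, $t\ge 0$. The transpose top with random measure on $S_n$ is $q(\tau)=1/n$ if $\tau=(1,j)$ for some $1\le j\le n$ (with $(1,1)=e$ the identity), and $q(\tau)=0$ otherwise. *)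

theory Defs
  imports "HOL-Analysis.Analysis" "HOL-Combinatorics.Combinatorics"
begin

definition Sym :: "nat \<Rightarrow> (nat \<Rightarrow> nat) set" where
  "Sym n = {p. p permutes {1..n}}"

text \<open>Convolution on S_n: law of xi1 * xi2 (product = composition xi1 o xi2).\<close>
definition conv :: "nat \<Rightarrow> ((nat \<Rightarrow> nat) \<Rightarrow> real) \<Rightarrow> ((nat \<Rightarrow> nat) \<Rightarrow> real)
    \<Rightarrow> (nat \<Rightarrow> nat) \<Rightarrow> real" where
  "conv n p q x = (\<Sum>y\<in>Sym n. p y * q (inv y \<circ> x))"

fun conv_pow :: "nat \<Rightarrow> ((nat \<Rightarrow> nat) \<Rightarrow> real) \<Rightarrow> nat \<Rightarrow> (nat \<Rightarrow> nat) \<Rightarrow> real" where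
  "conv_pow n q 0 = (\<lambda>x. if x = id then 1 else 0)"
| "conv_pow n q (Suc k) = conv n (conv_pow n q k) q"

definition d2 :: "nat \<Rightarrow> ((nat \<Rightarrow> nat) \<Rightarrow> real) \<Rightarrow> real" where
  "d2 n p = sqrt (real (card (Sym n)) *
      (\<Sum>x\<in>Sym n. \<bar>p x - 1 / real (card (Sym n))\<bar>^2))"

definition heat :: "nat \<Rightarrow> ((nat \<Rightarrow> nat) \<Rightarrow> real) \<Rightarrow> real \<Rightarrow> (nat \<Rightarrow> nat) \<Rightarrow> real" where
  "heat n q t x = exp (- t) * (\<Sum>k. t ^ k / fact k * conv_pow n q k x)"

definition ttr :: "nat \<Rightarrow> (nat \<Rightarrow> nat) \<Rightarrow> real" where
  "ttr n \<tau> = (if \<exists>j\<in>{1..n}. \<tau> = Transposition.transpose (1::nat) j then 1 / real n else 0)"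

end

theory Submission
  imports Defs
begin

text \<open>
  Let \<open>J = 1 + \<Sum>\<^sub>i\<^sub>\<ge>\<^sub>2 (1 i)\<close> act on functions on the symmetric group by right translation, so that one
  step of the walk is \<open>J / n\<close>. If \<open>A\<close> and \<open>B\<close> are the stars centred at \<open>b\<close> and \<open>c\<close> (Jucys--Murphy
  elements) and \<open>s = (b c)\<close>, then \<open>B s = s A + 1\<close> and \<open>s A - A s\<close> intertwines \<open>A\<close> with \<open>B\<close>; hence by
  induction all eigenvalues of stars are integers.

  Let \<open>f\<close> have no component invariant under the symmetric group of any \<open>m\<close>-subset of the \<open>n\<close> points.
  Then \<open>J f = k f\<close> with \<open>f \<noteq> 0\<close> forces \<open>k \<le> m - 1\<close>. For \<open>n = m\<close> this holds because \<open>J\<close> is a sum of \<open>m\<close>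
  isometries, and \<open>k = m\<close> would make \<open>f\<close> invariant. For larger \<open>n\<close> one averages over the stars with one
  leaf removed, which yields \<open>k < m\<close>, and integrality of \<open>k\<close> improves this to \<open>k \<le> m - 1\<close>.

  So the eigenspace of \<open>J\<close> for \<open>n - j\<close> lies in the span of the indicators of cosets of symmetric groups
  of \<open>(n - j)\<close>-subsets, and its dimension is at most \<open>n\<^bsup>2j\<^esup> / j!\<close>. Twisting by the sign maps the
  eigenvalue \<open>k\<close> to \<open>2 - k\<close> and gives the same bound for \<open>j + 2 - n\<close>. Summing,
  \<open>d\<^sub>2\<^sup>2 \<le> (e - 1) e\<^bsup>-2c\<^esup> + e e\<^bsup>-2c\<^esup> / 16 \<le> 2 e\<^bsup>-2c\<^esup>\<close>.
\<close>

section \<open>Finitely supported real functions\<close>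

text \<open>Group elements live in the infinite type \<open>nat \<Rightarrow> nat\<close>; finite
  support makes the l2 inner product a finite sum, so that these functions form a
  \<open>real_inner\<close> type.\<close>

typedef 'a fsfun = "{f :: 'a \<Rightarrow> real. finite {x. f x \<noteq> 0}}"
  morphisms coef Fs
  by (rule exI[of _ "\<lambda>_. 0"]) simp

setup_lifting type_definition_fsfun

lemma finite_support [simp]: "finite {x. coef f x \<noteq> 0}"
  using coef[of f] by simp

lemma coef_inject_ext: "(\<And>x. coef f x = coef g x) \<Longrightarrow> f = g"
  by (metis coef_inject ext)

instantiation fsfun :: (type) real_vector
begin

lift_definition zero_fsfun :: "'a fsfun" is "\<lambda>_. 0" by simp
lift_definition plus_fsfun :: "'a fsfun \<Rightarrow> 'a fsfun \<Rightarrow> 'a fsfun" is "\<lambda>f g x. f x + g x"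
  subgoal for f g by (rule finite_subset[of _ "{x. f x \<noteq> 0} \<union> {x. g x \<noteq> 0}"]) auto done
lift_definition minus_fsfun :: "'a fsfun \<Rightarrow> 'a fsfun \<Rightarrow> 'a fsfun" is "\<lambda>f g x. f x - g x"
  subgoal for f g by (rule finite_subset[of _ "{x. f x \<noteq> 0} \<union> {x. g x \<noteq> 0}"]) auto done
lift_definition uminus_fsfun :: "'a fsfun \<Rightarrow> 'a fsfun" is "\<lambda>f x. - f x" by simp
lift_definition scaleR_fsfun :: "real \<Rightarrow> 'a fsfun \<Rightarrow> 'a fsfun" is "\<lambda>c f x. c * f x"
  by (erule rev_finite_subset) auto

instance
  by standard (transfer; simp add: algebra_simps)+

end

instantiation fsfun :: (type) real_inner
begin

definition inner_fsfun :: "'a fsfun \<Rightarrow> 'a fsfun \<Rightarrow> real"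
  where "inner_fsfun f g = (\<Sum>x | coef f x \<noteq> 0. coef f x * coef g x)"
definition norm_fsfun :: "'a fsfun \<Rightarrow> real"
  where "norm_fsfun f = sqrt (inner f f)"
definition dist_fsfun :: "'a fsfun \<Rightarrow> 'a fsfun \<Rightarrow> real"
  where "dist_fsfun f g = norm (f - g)"
definition sgn_fsfun :: "'a fsfun \<Rightarrow> 'a fsfun"
  where "sgn_fsfun f = f /\<^sub>R norm f"
definition uniformity_fsfun :: "('a fsfun \<times> 'a fsfun) filter"
  where "uniformity_fsfun = (INF e\<in>{0 <..}. principal {(x, y). dist x y < e})"
definition open_fsfun :: "'a fsfun set \<Rightarrow> bool"
  where "open_fsfun U \<longleftrightarrow> (\<forall>x\<in>U. \<forall>\<^sub>F (x', y) in uniformity. x' = x \<longrightarrow> y \<in> U)"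

lemma inner_fsfun_eq:
  assumes "finite A" "\<And>x. x \<notin> A \<Longrightarrow> coef f x = 0"
  shows "inner f g = (\<Sum>x\<in>A. coef f x * coef g x)"
  unfolding inner_fsfun_def using assms by (intro sum.mono_neutral_left) auto

instance
proof
  fix f g h :: "'a fsfun" and r :: real
  let ?A = "{x. coef f x \<noteq> 0} \<union> {x. coef g x \<noteq> 0} \<union> {x. coef h x \<noteq> 0}"
  have A: "finite ?A" by simp
  show "inner f g = inner g f"
    by (subst (1 2) inner_fsfun_eq[OF A]) (auto simp: mult.commute)
  show "inner (f + g) h = inner f h + inner g h"
    by (subst (1 2 3) inner_fsfun_eq[OF A]) (auto simp: plus_fsfun.rep_eq algebra_simps sum.distrib)
  show "inner (r *\<^sub>R f) g = r * inner f g"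
    by (subst (1 2) inner_fsfun_eq[OF A]) (auto simp: scaleR_fsfun.rep_eq sum_distrib_left algebra_simps)
  show "0 \<le> inner f f"
    unfolding inner_fsfun_def by (intro sum_nonneg) simp
  show "inner f f = 0 \<longleftrightarrow> f = 0"
    unfolding inner_fsfun_def
    by (subst sum_nonneg_eq_0_iff) (auto intro!: coef_inject_ext simp: zero_fsfun.rep_eq)
  show "norm f = sqrt (inner f f)"
    by (rule norm_fsfun_def)
qed (simp_all add: dist_fsfun_def sgn_fsfun_def uniformity_fsfun_def open_fsfun_def)

end

lemmas coef_simps [simp] = zero_fsfun.rep_eq plus_fsfun.rep_eq minus_fsfun.rep_eq
  uminus_fsfun.rep_eq scaleR_fsfun.rep_eq

lemma coef_sum [simp]: "coef (sum f A) x = (\<Sum>i\<in>A. coef (f i) x)"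
  by (induction A rule: infinite_finite_induct) auto

lift_definition delta :: "'a \<Rightarrow> 'a fsfun" is "\<lambda>a x. if x = a then 1 else 0"
  by simp

lemma inner_delta: "inner f (delta a) = coef f a"
  by (subst inner_fsfun_eq[where A = "insert a {x. coef f x \<noteq> 0}"]) (auto simp: delta.rep_eq if_distrib sum.delta cong: if_cong)

definition indic :: "'a set \<Rightarrow> 'a fsfun"
  where "indic C = (\<Sum>x\<in>C. delta x)"

lemma inner_indic: "inner f (indic C) = (\<Sum>x\<in>C. coef f x)"
  by (simp add: indic_def inner_sum_right inner_delta)

lemma coef_indic: "finite C \<Longrightarrow> coef (indic C) x = (if x \<in> C then 1 else 0)"
  by (simp add: indic_def delta.rep_eq)

section \<open>Polynomials in an operator\<close>

text \<open>This is p(T) f, evaluated by Horner's scheme.\<close>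

definition pact :: "real poly \<Rightarrow> ('v::real_vector \<Rightarrow> 'v) \<Rightarrow> 'v \<Rightarrow> 'v"
  where "pact p T f = fold_coeffs (\<lambda>c g. c *\<^sub>R f + T g) p 0"

context
  fixes T :: "'v::real_vector \<Rightarrow> 'v"
  assumes lin: "linear T"
begin

lemma pact_0 [simp]: "pact 0 T f = 0"
  by (simp add: pact_def)

lemma pact_pCons [simp]: "pact (pCons c p) T f = c *\<^sub>R f + T (pact p T f)"
  by (cases "c = 0 \<and> p = 0") (auto simp: pact_def linear_0[OF lin])

lemma pact_add: "pact (p + q) T f = pact p T f + pact q T f"
  by (induction p q rule: poly_induct2) (auto simp: linear_add[OF lin] algebra_simps)

lemma pact_smult: "pact (smult c p) T f = c *\<^sub>R pact p T f"
  by (induction p) (auto simp: linear_scale[OF lin] algebra_simps)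

lemma pact_mult: "pact (p * q) T f = pact p T (pact q T f)"
  by (induction p) (auto simp: pact_add pact_smult)

lemma linear_pact: "linear (pact p T)"
proof (induction p)
  case 0 show ?case by (auto intro!: linearI)
next
  case (pCons c p)
  show ?case
    by (rule linearI) (auto simp: linear_add[OF pCons(2)] linear_scale[OF pCons(2)]
        linear_add[OF lin] linear_scale[OF lin] algebra_simps)
qed

lemma pact_dvd_eq_0:
  assumes "pact p T f = 0" "p dvd q"
  shows "pact q T f = 0"
proof -
  from assms(2) obtain r where "q = r * p" by (auto simp: dvd_def mult.commute)
  then show ?thesis by (simp add: pact_mult assms linear_0[OF linear_pact])
qed

end

lemma pact_intertwine:
  assumes A: "linear A" and B: "linear B" and phi: "linear \<phi>" and tw: "\<And>g. \<phi> (B g) = A (\<phi> g)"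
  shows "\<phi> (pact p B g) = pact p A (\<phi> g)"
  by (induction p) (auto simp: A B linear_0[OF phi] linear_add[OF phi] linear_scale[OF phi] tw)

lemma pact_selfadjoint:
  fixes T :: "'v::real_inner \<Rightarrow> 'v"
  assumes lin: "linear T" and sa: "\<And>f g. inner (T f) g = inner f (T g)"
  shows "inner (pact p T f) g = inner f (pact p T g)"
proof (induction p arbitrary: g)
  case (pCons c p)
  have "T (pact p T g) = pact p T (T g)"
    by (rule pact_intertwine[OF lin lin lin]) simp
  then show ?case using pCons by (auto simp: lin sa inner_simps)
qed (simp add: lin)

text \<open>Self-adjointness turns the squared norm of q(T) f into the inner product of f with q(T)
  q(T) f. Later this reduces multiple roots to simple ones.\<close>

lemma pact_square_eq_0:
  fixes T :: "'v::real_inner \<Rightarrow> 'v"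
  assumes "linear T" "\<And>f g. inner (T f) g = inner f (T g)" "pact q T (pact q T f) = 0"
  shows "pact q T f = 0"
proof -
  have "inner (pact q T f) (pact q T f) = inner f (pact q T (pact q T f))"
    by (rule pact_selfadjoint[OF assms(1,2)])
  then show ?thesis by (simp add: assms(3))
qed

text \<open>Induction on the roots: applying \<open>T - b\<close> removes the root \<open>b\<close>,
  the eigencomponents obtained are divided by \<open>k - b\<close>, and what is left of
  \<open>f\<close> is a \<open>b\<close>-eigenvector. Everything stays in the invariant subspace
  \<open>U\<close>.\<close>

lemma eigen_decomposition:
  fixes T :: "'v::real_vector \<Rightarrow> 'v"
  assumes lin: "linear T" and "finite K" and U: "subspace U" "\<And>f. f \<in> U \<Longrightarrow> T f \<in> U"
    and "f \<in> U" and "pact (\<Prod>k\<in>K. [:- k, 1:]) T f = 0"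
  shows "\<exists>d. f = (\<Sum>k\<in>K. d k) \<and> (\<forall>k\<in>K. d k \<in> U \<and> T (d k) = k *\<^sub>R d k)"
  using assms(2,5,6)
proof (induction K arbitrary: f rule: finite_induct)
  case empty
  then show ?case by (simp add: lin one_pCons linear_0[OF lin])
next
  case (insert b K)
  let ?g = "T f - b *\<^sub>R f"
  have "?g \<in> U" using insert.prems(1) U by (simp add: subspace_diff subspace_scale)
  moreover have "pact (\<Prod>k\<in>K. [:- k, 1:]) T ?g = 0"
  proof -
    have "pact [:- b, 1:] T f = ?g" by (simp add: lin linear_0[OF lin])
    then show ?thesis
      using insert.prems(2) pact_mult[OF lin, of "\<Prod>k\<in>K. [:- k, 1:]" "[:- b, 1:]" f]
      by (simp only: prod.insert[OF insert.hyps] mult.commute)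
  qed
  ultimately obtain e where e: "?g = (\<Sum>k\<in>K. e k)"
    "\<And>k. k \<in> K \<Longrightarrow> e k \<in> U" "\<And>k. k \<in> K \<Longrightarrow> T (e k) = k *\<^sub>R e k"
    using insert.IH by blast
  define d where "d k = inverse (k - b) *\<^sub>R e k" for k
  define h where "h = f - (\<Sum>k\<in>K. d k)"
  have dU: "d k \<in> U" "T (d k) = k *\<^sub>R d k" "T (d k) - b *\<^sub>R d k = e k" if "k \<in> K" for k
  proof -
    have "k - b \<noteq> 0" using insert.hyps that by auto
    then show "d k \<in> U" "T (d k) = k *\<^sub>R d k" "T (d k) - b *\<^sub>R d k = e k"
      using e(2,3)[OF that] U(1)
      by (auto simp: d_def subspace_scale linear_scale[OF lin] scaleR_diff_left[symmetric]
          left_diff_distrib[symmetric] right_diff_distrib[symmetric] mult.commute)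
  qed
  have hU: "h \<in> U" unfolding h_def using dU insert.prems(1) U(1)
    by (simp add: subspace_diff subspace_sum)
  have "T h - b *\<^sub>R h = ?g - (\<Sum>k\<in>K. T (d k) - b *\<^sub>R d k)"
    by (simp add: h_def linear_diff[OF lin] linear_sum[OF lin] scaleR_diff_right scaleR_sum_right sum_subtractf)
  also have "\<dots> = 0" using e(1) dU(3) by simp
  finally have "T h = b *\<^sub>R h" by simp
  then show ?case
    using hU dU insert.hyps
    by (intro exI[of _ "d(b := h)"]) (auto simp: h_def intro!: sum.cong)
qed

lemma eigen_orthogonal:
  fixes T :: "'v::real_inner \<Rightarrow> 'v"
  assumes "\<And>f g. inner (T f) g = inner f (T g)" "T f = a *\<^sub>R f" "T g = b *\<^sub>R g" "a \<noteq> b"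
  shows "inner f g = 0"
  using assms(1)[of f g] assms(2-4) by simp

section \<open>Translation operators and star sums\<close>

text \<open>\<open>Fs\<close> is meaningful only for finite support, which precomposition with a
  bijection preserves; hence the \<open>bij\<close> assumptions below.\<close>

definition pull :: "('a \<Rightarrow> 'a) \<Rightarrow> 'a fsfun \<Rightarrow> 'a fsfun"
  where "pull \<phi> f = Fs (\<lambda>x. coef f (\<phi> x))"

lemma coef_pull:
  assumes "bij \<phi>"
  shows "coef (pull \<phi> f) x = coef f (\<phi> x)"
proof -
  have "finite {x. coef f (\<phi> x) \<noteq> 0}"
    using finite_vimageI[OF finite_support[of f] bij_is_inj[OF assms]] by (simp add: vimage_def)
  then show ?thesis by (simp add: pull_def Fs_inverse)
qed

lemma linear_pull: "bij \<phi> \<Longrightarrow> linear (pull \<phi>)"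
  by (rule linearI) (auto intro!: coef_inject_ext simp: coef_pull)

lemma inner_pull_left:
  assumes "bij \<phi>"
  shows "inner (pull \<phi> f) g = inner f (pull (inv \<phi>) g)"
proof -
  have "bij (inv \<phi>)" using assms by (rule bij_imp_bij_inv)
  then show ?thesis
    unfolding inner_fsfun_def using assms
    by (intro sum.reindex_bij_witness[of _ "inv \<phi>" \<phi>])
       (auto simp: coef_pull bij_is_inj bij_is_surj surj_f_inv_f)
qed

abbreviation (input) swp :: "'a \<Rightarrow> 'a \<Rightarrow> 'a \<Rightarrow> 'a"
  where "swp \<equiv> Transposition.transpose"

definition rtr :: "('a \<Rightarrow> 'a) \<Rightarrow> ('a \<Rightarrow> 'a) fsfun \<Rightarrow> ('a \<Rightarrow> 'a) fsfun"
  where "rtr g = pull (\<lambda>x. x \<circ> g)"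

text \<open>Left translations commute with right ones, hence with the walk; they only move its
  starting point.\<close>

definition ltr :: "('a \<Rightarrow> 'a) \<Rightarrow> ('a \<Rightarrow> 'a) fsfun \<Rightarrow> ('a \<Rightarrow> 'a) fsfun"
  where "ltr g = pull (\<lambda>x. g \<circ> x)"

lemma bij_comp_right: "bij g \<Longrightarrow> bij (\<lambda>x. x \<circ> g)"
  by (rule bij_betw_byWitness[where f' = "\<lambda>x. x \<circ> inv g"])
     (auto simp: comp_assoc bij_is_inj bij_is_surj surj_iff[symmetric] inj_iff[symmetric]
        surj_iff[THEN iffD1] inj_iff[THEN iffD1])

lemma bij_comp_left: "bij g \<Longrightarrow> bij (\<lambda>x. g \<circ> x)"
  by (rule bij_betw_byWitness[where f' = "\<lambda>x. inv g \<circ> x"])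
     (auto simp: comp_assoc[symmetric] bij_is_inj bij_is_surj
        surj_iff[THEN iffD1] inj_iff[THEN iffD1])

lemma coef_rtr: "bij g \<Longrightarrow> coef (rtr g f) x = coef f (x \<circ> g)"
  by (simp add: rtr_def coef_pull bij_comp_right)

lemma coef_ltr: "bij g \<Longrightarrow> coef (ltr g f) x = coef f (g \<circ> x)"
  by (simp add: ltr_def coef_pull bij_comp_left)

lemma linear_rtr: "bij g \<Longrightarrow> linear (rtr g)"
  by (simp add: rtr_def linear_pull bij_comp_right)

lemma rtr_rtr: "bij g \<Longrightarrow> bij h \<Longrightarrow> rtr g (rtr h f) = rtr (g \<circ> h) f"
  by (rule coef_inject_ext) (simp add: coef_rtr bij_comp comp_assoc)

lemma rtr_id [simp]: "rtr id f = f"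
  by (rule coef_inject_ext) (simp add: coef_rtr)

lemma inner_rtr_left:
  fixes g :: "'a \<Rightarrow> 'a"
  assumes "bij g"
  shows "inner (rtr g f) h = inner f (rtr (inv g) h)"
proof -
  have "inv (\<lambda>x :: 'a \<Rightarrow> 'a. x \<circ> g) = (\<lambda>x. x \<circ> inv g)"
    using assms by (intro inv_unique_comp) (auto simp: fun_eq_iff bij_is_surj surj_f_inv_f bij_is_inj)
  then show ?thesis unfolding rtr_def inner_pull_left[OF bij_comp_right[OF assms]] by simp
qed

lemma inner_ltr_left:
  fixes g :: "'a \<Rightarrow> 'a"
  assumes "bij g"
  shows "inner (ltr g f) h = inner f (ltr (inv g) h)"
proof -
  have "inv (\<lambda>x :: 'a \<Rightarrow> 'a. g \<circ> x) = (\<lambda>x. inv g \<circ> x)"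
    using assms by (intro inv_unique_comp) (auto simp: fun_eq_iff bij_is_surj surj_f_inv_f bij_is_inj)
  then show ?thesis unfolding ltr_def inner_pull_left[OF bij_comp_left[OF assms]] by simp
qed

lemma norm_rtr [simp]: "bij g \<Longrightarrow> norm (rtr g f) = norm f"
  by (simp add: norm_eq_sqrt_inner inner_rtr_left rtr_rtr bij_imp_bij_inv bij_is_inj inj_iff[THEN iffD1])

lemma norm_ltr [simp]:
  assumes "bij g" shows "norm (ltr g f) = norm f"
proof -
  have "ltr (inv g) (ltr g f) = f"
    by (rule coef_inject_ext)
       (simp add: assms coef_ltr bij_imp_bij_inv comp_assoc[symmetric] bij_is_surj surj_iff[THEN iffD1])
  then show ?thesis by (simp add: norm_eq_sqrt_inner inner_ltr_left assms)
qed

definition star :: "'a set \<Rightarrow> 'a \<Rightarrow> ('a \<Rightarrow> 'a) fsfun \<Rightarrow> ('a \<Rightarrow> 'a) fsfun"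
  where "star S c f = (\<Sum>i\<in>S. rtr (swp i c) f)"

lemma linear_star: "linear (star S c)"
  unfolding star_def
  by (intro linear_compose_sum ballI linear_rtr) simp

lemma inner_star: "inner (star S c f) g = inner f (star S c g)"
  by (simp add: star_def inner_sum_left inner_sum_right inner_rtr_left)

lemma star_in:
  assumes "subspace U" "\<And>f i. f \<in> U \<Longrightarrow> i \<in> S \<Longrightarrow> rtr (swp i c) f \<in> U" "f \<in> U"
  shows "star S c f \<in> U"
  using assms by (auto simp: star_def intro!: subspace_sum)

section \<open>Integrality of the spectrum\<close>

lemma swp_conj: "i \<noteq> b \<Longrightarrow> i \<noteq> c \<Longrightarrow> b \<noteq> c \<Longrightarrow> swp i c \<circ> swp b c = swp b c \<circ> swp i b"
  by (auto simp: fun_eq_iff Transposition.transpose_def)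

lemma swp_conj': "i \<noteq> b \<Longrightarrow> i \<noteq> c \<Longrightarrow> b \<noteq> c \<Longrightarrow> swp b c \<circ> swp i c = swp i b \<circ> swp b c"
  by (auto simp: fun_eq_iff Transposition.transpose_def)

text \<open>Conjugation by (b c) exchanges the centres \<open>b\<close> and \<open>c\<close>; the
  leaf \<open>b\<close> contributes the square of (b c), which is the extra
  \<open>g\<close>.\<close>

lemma star_swap:
  assumes "finite S" "b \<notin> S" "c \<notin> S" "b \<noteq> c"
  shows "star (insert b S) c (rtr (swp b c) g) = rtr (swp b c) (star S b g) + g"
    and "rtr (swp b c) (star (insert b S) c g) = star S b (rtr (swp b c) g) + g"
proof -
  have "rtr (swp i c) (rtr (swp b c) g) = rtr (swp b c) (rtr (swp i b) g)"
    "rtr (swp b c) (rtr (swp i c) g) = rtr (swp i b) (rtr (swp b c) g)" if "i \<in> S" for i g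
    using assms that by (metis bij_transpose rtr_rtr swp_conj, metis bij_transpose rtr_rtr swp_conj')
  then show "star (insert b S) c (rtr (swp b c) g) = rtr (swp b c) (star S b g) + g"
    "rtr (swp b c) (star (insert b S) c g) = star S b (rtr (swp b c) g) + g"
    using assms by (auto simp: star_def linear_sum[OF linear_rtr] linear_add[OF linear_rtr] rtr_rtr
        intro!: sum.cong)
qed

text \<open>Conjugation by (i b) with \<open>i \<in> S\<close> permutes the leaves
  \<open>insert b S\<close> and fixes \<open>c\<close>, so each term of the smaller star commutes
  with the larger star.\<close>

lemma star_commute:
  assumes "finite S" "b \<notin> S" "c \<notin> S" "b \<noteq> c"
  shows "star S b (star (insert b S) c g) = star (insert b S) c (star S b g)"
proof -
  have *: "rtr (swp i b) (star (insert b S) c g) = star (insert b S) c (rtr (swp i b) g)" if "i \<in> S" for i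
  proof -
    have "rtr (swp i b) (star (insert b S) c g) = (\<Sum>j\<in>insert b S. rtr (swp i b \<circ> swp j c) g)"
      by (simp add: star_def linear_sum[OF linear_rtr] rtr_rtr)
    also have "\<dots> = (\<Sum>j\<in>insert b S. rtr (swp (swp i b j) c \<circ> swp i b) g)"
      using assms that
      by (intro sum.cong refl arg_cong[where f = "\<lambda>h. rtr h g"])
         (auto simp: fun_eq_iff Transposition.transpose_def)
    also have "\<dots> = (\<Sum>j\<in>insert b S. rtr (swp j c \<circ> swp i b) g)"
      using that by (intro sum.reindex_bij_betw) simp
    also have "\<dots> = star (insert b S) c (rtr (swp i b) g)"
      by (simp add: star_def rtr_rtr)
    finally show ?thesis .
  qed
  have "star S b (star (insert b S) c g) = (\<Sum>i\<in>S. star (insert b S) c (rtr (swp i b) g))"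
    unfolding star_def[of S b] by (intro sum.cong refl *)
  also have "\<dots> = star (insert b S) c (star S b g)"
    unfolding star_def[of S b] by (rule linear_sum[OF linear_star, symmetric])
  finally show ?thesis .
qed

text \<open>All roots are simple, so annihilation by it yields both diagonalisability and an
  integral spectrum.\<close>

definition zpoly :: "nat \<Rightarrow> real poly"
  where "zpoly k = (\<Prod>a\<in>real_of_int ` {- int k..int k}. [:- a, 1:])"

lemma zpoly_dvd: "zpoly k dvd zpoly (Suc k)"
  unfolding zpoly_def by (rule prod_dvd_prod_subset) auto

text \<open>Adding a leaf can move an eigenvalue \<open>a\<close> to \<open>a - 1\<close> or
  \<open>a + 1\<close>; both are distinct roots in the range widened by one.\<close>

lemma factors_dvd_zpoly:
  assumes "a \<in> real_of_int ` {- int k..int k}"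
  shows "[:- (a - 1), 1:] * [:- (a + 1), 1:] dvd zpoly (Suc k)"
proof -
  from assms obtain i where i: "a = of_int i" "- int k \<le> i" "i \<le> int k" by auto
  have "[:- (a - 1), 1:] * [:- (a + 1), 1:] = (\<Prod>b\<in>{a - 1, a + 1}. [:- b, 1:])"
    by (subst prod.insert) auto
  also have "\<dots> dvd zpoly (Suc k)"
    unfolding zpoly_def
  proof (rule prod_dvd_prod_subset)
    have "a - 1 = of_int (i - 1)" "a + 1 = of_int (i + 1)" using i by auto
    moreover have "i - 1 \<in> {- int (Suc k)..int (Suc k)}" "i + 1 \<in> {- int (Suc k)..int (Suc k)}"
      using i by auto
    ultimately show "{a - 1, a + 1} \<subseteq> real_of_int ` {- int (Suc k)..int (Suc k)}"
      by (metis (no_types, lifting) empty_subsetI image_eqI insert_subset)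
  qed simp
  finally show ?thesis .
qed

text \<open>Induction on the leaves: \<open>f\<close> is split into eigenvectors of the smaller star
  \<open>A\<close>, and each of them is shown to be annihilated by the next polynomial in
  \<open>B\<close>.\<close>

theorem zpoly_star: "finite S \<Longrightarrow> c \<notin> S \<Longrightarrow> pact (zpoly (card S)) (star S c) f = 0"
proof (induction S arbitrary: c f rule: finite_induct)
  case empty
  have "star {} c = (\<lambda>f. 0)" by (simp add: star_def fun_eq_iff)
  moreover have "linear ((\<lambda>_. 0) :: ('a \<Rightarrow> 'a) fsfun \<Rightarrow> ('a \<Rightarrow> 'a) fsfun)" by (auto intro: linearI)
  ultimately show ?case by (simp add: zpoly_def)
next
  case (insert b S)
  define A B s where "A = star S b" and "B = star (insert b S) c" and "s = rtr (swp b c)"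
  let ?p = "zpoly (card S)" and ?q = "zpoly (Suc (card S))"
  have bc: "b \<notin> S" "c \<notin> S" "b \<noteq> c" using insert by auto
  note linA = linear_star[of S b, folded A_def]
  note linB = linear_star[of "insert b S" c, folded B_def]
  have lins: "linear s" unfolding s_def by (rule linear_rtr) simp
  note Bs = star_swap(1)[OF insert.hyps(1) bc, folded A_def B_def s_def]
  note sB = star_swap(2)[OF insert.hyps(1) bc, folded A_def B_def s_def]
  note AB = star_commute[OF insert.hyps(1) bc, folded A_def B_def]
  have ss: "s (s g) = g" for g unfolding s_def by (simp add: rtr_rtr)
  have pA: "pact ?p A g = 0" for g unfolding A_def by (rule insert.IH) (fact bc)
  txt \<open>The intertwiner of the degenerate affine Hecke algebra; \<open>\<phi>\<^sup>2 = 1 - (A - B)\<^sup>2\<close>, so on the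
    \<open>a\<close>-eigenspace of \<open>A\<close> the kernel of \<open>\<phi>\<close> only carries the eigenvalues \<open>a - 1\<close> and \<open>a + 1\<close> of \<open>B\<close>.\<close>
  define \<phi> where "\<phi> g = s (A g) - A (s g)" for g
  have lin\<phi>: "linear \<phi>" unfolding \<phi>_def
    by (intro linear_compose_sub linear_compose[OF linA lins, unfolded o_def]
        linear_compose[OF lins linA, unfolded o_def])
  have tw: "\<phi> (B g) = A (\<phi> g)" for g
    by (simp add: \<phi>_def AB sB linear_add[OF linA] linear_diff[OF linA])
  have *: "pact ?q B g = 0" if g: "A g = a *\<^sub>R g" and a: "a \<in> real_of_int ` {- int (card S)..int (card S)}" for a g
  proof -
    define u where "u = pact ?p B g"
    have "A u = pact ?p B (A g)"
      unfolding u_def by (rule pact_intertwine[OF linB linB linA AB])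
    then have Au: "A u = a *\<^sub>R u"
      by (simp add: g u_def linear_scale[OF linear_pact[OF linB]])
    \<comment> \<open>The intertwining carries \<open>pact ?p B\<close> to \<open>pact ?p A\<close>,
      which vanishes by induction.\<close>
    have "\<phi> u = 0"
      unfolding u_def using pact_intertwine[OF linA linB lin\<phi> tw] pA by simp
    then have Asu: "A (s u) = a *\<^sub>R s u"
      by (simp add: \<phi>_def Au linear_scale[OF lins])
    have "s (B u) = a *\<^sub>R s u + u" by (simp add: sB Asu)
    then have "s (s (B u)) = a *\<^sub>R u + s u" by (simp add: linear_add[OF lins] linear_scale[OF lins] ss)
    then have Bu: "B u = a *\<^sub>R u + s u" by (simp add: ss)
    have Bsu: "B (s u) = a *\<^sub>R s u + u" by (simp add: Bs Au linear_scale[OF lins])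
    \<comment> \<open>On the span of \<open>u\<close> and \<open>s u\<close> the operator
      \<open>B - a\<close> acts as the involution \<open>s\<close>, so its square is 1
      there.\<close>
    have "pact ([:- (a - 1), 1:] * [:- (a + 1), 1:]) B u = 0"
      by (simp only: pact_mult[OF linB])
         (simp add: linB linear_0[OF linB] Bu Bsu linear_add[OF linB] linear_diff[OF linB] linear_scale[OF linB] algebra_simps)
    then have qu: "pact ?q B u = 0"
      using factors_dvd_zpoly[OF a] by (rule pact_dvd_eq_0[OF linB])
    obtain r where r: "?q = r * ?p" using zpoly_dvd[of "card S"] by (auto simp: dvd_def mult.commute)
    \<comment> \<open>Writing one factor \<open>?q\<close> as \<open>r * ?p\<close> produces
      \<open>u\<close>, which the other factor kills; the square is then removed by
      self-adjointness.\<close>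
    have "pact ?q B (pact ?q B g) = pact ?q B (pact r B u)"
      by (simp add: r u_def pact_mult[OF linB])
    also have "\<dots> = pact r B (pact ?q B u)"
      by (simp add: pact_mult[OF linB, symmetric] mult.commute)
    also have "\<dots> = 0" by (simp add: qu linear_0[OF linear_pact[OF linB]])
    finally show ?thesis
      by (rule pact_square_eq_0[OF linB inner_star[of "insert b S" c, folded B_def]])
  qed
  obtain d where d: "f = (\<Sum>k\<in>real_of_int ` {- int (card S)..int (card S)}. d k)"
    "\<And>k. k \<in> real_of_int ` {- int (card S)..int (card S)} \<Longrightarrow> A (d k) = k *\<^sub>R d k"
    using eigen_decomposition[OF linA _ subspace_UNIV _ _ pA[unfolded zpoly_def], of f] by auto
  have "pact ?q B f = (\<Sum>k\<in>real_of_int ` {- int (card S)..int (card S)}. pact ?q B (d k))"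
    unfolding d(1) by (rule linear_sum[OF linear_pact[OF linB]])
  also have "\<dots> = 0" using * d(2) by (intro sum.neutral) blast
  finally show ?case using insert.hyps by (simp add: B_def)
qed

section \<open>Functions without symmetric components\<close>

text \<open>For finite \<open>A\<close> this is, up to the factor |A|!, the orthogonal projection
  onto the functions invariant under right translation by permutations of \<open>A\<close>.\<close>

definition symm :: "'a set \<Rightarrow> ('a \<Rightarrow> 'a) fsfun \<Rightarrow> ('a \<Rightarrow> 'a) fsfun"
  where "symm A f = (\<Sum>g | g permutes A. rtr g f)"

lemma linear_symm: "linear (symm A)"
  unfolding symm_def by (intro linear_compose_sum ballI linear_rtr) (auto intro: permutes_bij)

definition symfree :: "'a set \<Rightarrow> nat \<Rightarrow> ('a \<Rightarrow> 'a) fsfun set"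
  where "symfree N m = {f. \<forall>A\<subseteq>N. card A = m \<longrightarrow> symm A f = 0}"

lemma subspace_symfree: "subspace (symfree N m)"
  by (auto simp: subspace_def symfree_def linear_0[OF linear_symm] linear_add[OF linear_symm]
      linear_scale[OF linear_symm])

lemma swp_conj_permutes:
  assumes "g permutes A"
  shows "swp i c \<circ> g \<circ> swp i c permutes swp i c ` A"
proof -
  have "bij (swp i c \<circ> g \<circ> swp i c)"
    using assms by (intro bij_comp bij_transpose permutes_bij)
  moreover have "(swp i c \<circ> g \<circ> swp i c) x = x" if "x \<notin> swp i c ` A" for x
    using that assms by (simp add: in_transpose_image_iff permutes_not_in)
  ultimately show ?thesis
    unfolding permutes_def bij_iff by blast
qed

text \<open>Conjugation by (i c) carries the permutations of \<open>A\<close> to those of its image.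
  This makes \<open>symfree N m\<close> invariant under stars inside \<open>N\<close>.\<close>

lemma symm_rtr_swp: "symm A (rtr (swp i c) f) = rtr (swp i c) (symm (swp i c ` A) f)"
proof -
  let ?t = "swp i c"
  have tt: "?t \<circ> (?t \<circ> g \<circ> ?t) \<circ> ?t = g" for g :: "'a \<Rightarrow> 'a"
    by (simp add: fun_eq_iff)
  have "symm A (rtr ?t f) = (\<Sum>g | g permutes A. rtr (g \<circ> ?t) f)"
    unfolding symm_def by (intro sum.cong) (auto simp: rtr_rtr permutes_bij)
  also have "\<dots> = (\<Sum>g | g permutes ?t ` A. rtr (?t \<circ> g) f)"
  proof (rule sum.reindex_bij_witness[of _ "\<lambda>g. ?t \<circ> g \<circ> ?t" "\<lambda>g. ?t \<circ> g \<circ> ?t"])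
    fix g assume g: "g \<in> {g. g permutes ?t ` A}"
    then show "?t \<circ> g \<circ> ?t \<in> {g. g permutes A}"
      using swp_conj_permutes[of g "?t ` A" i c] by (simp add: image_comp)
  qed (auto simp: tt swp_conj_permutes comp_assoc[symmetric])
  also have "\<dots> = rtr ?t (symm (?t ` A) f)"
    unfolding symm_def by (subst linear_sum[OF linear_rtr]) (auto simp: rtr_rtr permutes_bij)
  finally show ?thesis .
qed

lemma symfree_rtr:
  assumes "f \<in> symfree N m" "i \<in> N" "c \<in> N"
  shows "rtr (swp i c) f \<in> symfree N m"
proof -
  have "symm (swp i c ` A) f = 0" if "A \<subseteq> N" "card A = m" for A
  proof -
    have "swp i c ` A \<subseteq> N" using that assms by (auto simp: Transposition.transpose_def)
    moreover have "card (swp i c ` A) = m" using that by (simp add: card_image)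
    ultimately show ?thesis using assms(1) by (simp add: symfree_def)
  qed
  then show ?thesis
    by (simp add: symfree_def symm_rtr_swp linear_0[OF linear_rtr])
qed

lemma symm_ltr: "bij h \<Longrightarrow> symm A (ltr h f) = ltr h (symm A f)"
  by (rule coef_inject_ext) (simp add: symm_def coef_rtr coef_ltr permutes_bij comp_assoc)

lemma symfree_ltr: "f \<in> symfree N m \<Longrightarrow> bij h \<Longrightarrow> ltr h f \<in> symfree N m"
  by (auto simp: symfree_def symm_ltr intro: coef_inject_ext simp: coef_ltr)

lemma symfree_1:
  assumes "f \<in> symfree N 1" "c \<in> N"
  shows "f = 0"
proof -
  have "symm {c} f = 0" using assms by (simp add: symfree_def)
  moreover have "{g. g permutes {c}} = {id}" by auto
  ultimately show ?thesis by (simp add: symm_def)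
qed

text \<open>The transpositions (i c) generate the symmetric group of \<open>insert c S\<close>, so
  \<open>f\<close> is invariant and its symmetrisation is a positive multiple of
  \<open>f\<close>.\<close>

lemma star_fixed_imp_0:
  assumes "finite S" "insert c S \<subseteq> N" "c \<notin> S" "f \<in> symfree N (Suc (card S))"
    and fx: "\<And>i. i \<in> S \<Longrightarrow> rtr (swp i c) f = f"
  shows "f = 0"
proof -
  have swpf: "rtr (swp a b) f = f" if ab: "a \<in> insert c S" "b \<in> insert c S" "a \<noteq> b" for a b
  proof (cases "a = c \<or> b = c")
    case True
    then show ?thesis using ab fx by (auto simp: transpose_commute)
  next
    case False
    then have "swp a b = swp a c \<circ> swp b c \<circ> swp a c"
      using ab by (auto simp: fun_eq_iff Transposition.transpose_def)
    then have "rtr (swp a b) f = rtr (swp a c) (rtr (swp b c) (rtr (swp a c) f))"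
      by (simp add: rtr_rtr bij_comp comp_assoc)
    then show ?thesis using False ab fx by simp
  qed
  have "rtr g f = f" if "g permutes insert c S" for g
    using that finite.insertI[OF assms(1)]
  proof (induction rule: permutes_induct)
    case id show ?case by (rule rtr_id)
  next
    case (swap a b p)
    then have "rtr (swp a b \<circ> p) f = rtr (swp a b) (rtr p f)"
      using permutes_bij rtr_rtr[of "swp a b" p f] by (metis bij_transpose)
    then show ?case using swap.IH swap.hyps swpf by metis
  qed
  then have "symm (insert c S) f = real (card {g. g permutes insert c S}) *\<^sub>R f"
    unfolding symm_def by (simp add: sum_constant_scaleR)
  moreover have "symm (insert c S) f = 0"
    using assms by (simp add: symfree_def)
  moreover have "card {g. g permutes insert c S} \<noteq> 0"
    using assms by (simp add: card_permutations)
  ultimately show ?thesis by simp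
qed

lemma integer_less_imp_le:
  fixes k :: real
  assumes "k \<in> range real_of_int" "k < real_of_int b + 1"
  shows "k \<le> real_of_int b"
  using assms by auto

text \<open>Expansion in orthogonal eigenvectors inside \<open>U\<close> turns a bound on integral
  eigenvalues into a bound on the quadratic form.\<close>

lemma star_quadratic_of_eigen:
  assumes "finite S" "c \<notin> S" and U: "subspace U" "\<And>f. f \<in> U \<Longrightarrow> star S c f \<in> U" and "f \<in> U"
    and eig: "\<And>g k. g \<in> U \<Longrightarrow> g \<noteq> 0 \<Longrightarrow> star S c g = k *\<^sub>R g \<Longrightarrow> k \<in> range real_of_int \<Longrightarrow> k \<le> M"
  shows "inner (star S c f) f \<le> M * inner f f"
proof -
  let ?K = "real_of_int ` {- int (card S)..int (card S)}"
  obtain d where d: "f = (\<Sum>k\<in>?K. d k)"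
    "\<And>k. k \<in> ?K \<Longrightarrow> d k \<in> U" "\<And>k. k \<in> ?K \<Longrightarrow> star S c (d k) = k *\<^sub>R d k"
    using eigen_decomposition[OF linear_star _ U assms(5) zpoly_star[OF assms(1,2), unfolded zpoly_def]]
    by auto
  have orth: "inner (d k) (d l) = (if l = k then inner (d k) (d k) else 0)" if "k \<in> ?K" "l \<in> ?K" for k l
    using eigen_orthogonal[OF inner_star d(3)[OF that(1)] d(3)[OF that(2)]] by auto
  have "inner (star S c f) f = (\<Sum>k\<in>?K. \<Sum>l\<in>?K. k * inner (d k) (d l))"
    by (subst (1 2) d(1))
       (simp add: linear_sum[OF linear_star] inner_sum_left inner_sum_right d(3) del: image_iff, rule sum.swap)
  also have "\<dots> = (\<Sum>k\<in>?K. \<Sum>l\<in>?K. if l = k then k * inner (d k) (d k) else 0)"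
    by (intro sum.cong refl) (subst orth, auto)
  also have "\<dots> = (\<Sum>k\<in>?K. k * inner (d k) (d k))" by simp
  also have "\<dots> \<le> (\<Sum>k\<in>?K. M * inner (d k) (d k))"
  proof (rule sum_mono)
    fix k assume k: "k \<in> ?K"
    show "k * inner (d k) (d k) \<le> M * inner (d k) (d k)"
    proof (cases "d k = 0")
      case False
      then have "k \<le> M" using eig[OF d(2)[OF k] False d(3)[OF k]] k by blast
      then show ?thesis by (intro mult_right_mono) auto
    qed simp
  qed
  also have "\<dots> = (\<Sum>k\<in>?K. \<Sum>l\<in>?K. if l = k then M * inner (d k) (d k) else 0)" by simp
  also have "\<dots> = (\<Sum>k\<in>?K. \<Sum>l\<in>?K. M * inner (d k) (d l))"
    by (intro sum.cong refl) (subst orth, auto)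
  also have "\<dots> = M * inner f f"
    by (subst (1 2) d(1)) (simp add: inner_sum_left inner_sum_right sum_distrib_left, rule sum.swap)
  finally show ?thesis .
qed

text \<open>Each leaf is missing from exactly one of the smaller stars.\<close>

lemma star_subsets_sum:
  assumes "finite S"
  shows "(\<Sum>i\<in>S. star (S - {i}) c f) = (real (card S) - 1) *\<^sub>R star S c f"
proof -
  have "(\<Sum>i\<in>S. star (S - {i}) c f) = (\<Sum>i\<in>S. star S c f - rtr (swp i c) f)"
    using assms by (intro sum.cong refl) (simp add: star_def sum_diff1)
  also have "\<dots> = (real (card S) - 1) *\<^sub>R star S c f"
    by (simp add: sum_subtractf sum_constant_scaleR scaleR_diff_left) (simp add: star_def)
  finally show ?thesis .
qed

text \<open>The bound is \<open>m - 2\<close> because \<open>star\<close> omits the identity term of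
  \<open>J\<close>. The quadratic form is what the induction needs: an eigenvector of a star need
  not be one of its smaller stars.\<close>

theorem star_quadratic_symfree:
  assumes "finite S" "insert c S \<subseteq> N" "c \<notin> S" "1 \<le> m" "m \<le> Suc (card S)" "f \<in> symfree N m"
  shows "inner (star S c f) f \<le> (real m - 2) * inner f f"
  using assms
proof (induction "card S" arbitrary: S f rule: less_induct)
  case less
  show ?case
  proof (rule star_quadratic_of_eigen[of S c "symfree N m"])
    show "finite S" "c \<notin> S" "subspace (symfree N m)" "f \<in> symfree N m"
      using less.prems by (auto simp: subspace_symfree)
    show "star S c g \<in> symfree N m" if "g \<in> symfree N m" for g
      using that less.prems by (intro star_in subspace_symfree symfree_rtr) auto
  next
    fix g k assume g: "g \<in> symfree N m" "g \<noteq> 0" "star S c g = k *\<^sub>R g" "k \<in> range real_of_int"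
    have pos: "inner g g > 0" using g(2) by simp
    \<comment> \<open>A strict bound suffices, since integrality of \<open>k\<close> then lowers it
      to \<open>m - 2\<close>.\<close>
    have "k < real m - 1"
    proof (cases "m = Suc (card S)")
      case True
      \<comment> \<open>Translations are isometries, so Cauchy-Schwarz bounds \<open>k\<close> by
        the number of leaves; equality would force every (i c) to fix \<open>g\<close>.\<close>
      have le: "inner (rtr (swp i c) g) g \<le> inner g g" for i
        using norm_cauchy_schwarz[of "rtr (swp i c) g" g]
        by (simp add: power2_norm_eq_inner[symmetric] power2_eq_square)
      have sum: "(\<Sum>i\<in>S. inner g g - inner (rtr (swp i c) g) g) = (real (card S) - k) * inner g g"
        using arg_cong[OF g(3), of "\<lambda>h. inner h g"]
        by (simp add: sum_subtractf star_def inner_sum_left left_diff_distrib)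
      have "0 \<le> (real (card S) - k) * inner g g"
        unfolding sum[symmetric] using le by (intro sum_nonneg) simp
      then have "k \<le> real (card S)" using pos by (simp add: zero_le_mult_iff)
      moreover have "k \<noteq> real (card S)"
      proof
        assume "k = real (card S)"
        then have eq0: "inner g g - inner (rtr (swp i c) g) g = 0" if "i \<in> S" for i
          using sum sum_nonneg_eq_0_iff[of S "\<lambda>i. inner g g - inner (rtr (swp i c) g) g"]
            le less.prems(1) that by simp
        have "rtr (swp i c) g = g" if "i \<in> S" for i
        proof -
          have "inner (rtr (swp i c) g) (rtr (swp i c) g) = inner g g"
            by (simp flip: power2_norm_eq_inner)
          then have "inner (rtr (swp i c) g - g) (rtr (swp i c) g - g) = 0"
            using eq0[OF that] by (simp add: inner_diff_left inner_diff_right inner_commute)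
          then show ?thesis by simp
        qed
        then have "g = 0" using star_fixed_imp_0[of S c N g] less.prems g True by auto
        then show False using g(2) by simp
      qed
      ultimately show ?thesis using True by simp
    next
      case False
      have "m \<noteq> 1" using symfree_1[of g N c] g less.prems by auto
      define r where "r = real (card S) - 1"
      have r: "real m \<le> r + 1" "r \<ge> 1" using False \<open>m \<noteq> 1\<close> less.prems by (auto simp: r_def)
      have "r * (k * inner g g) = (\<Sum>i\<in>S. inner (star (S - {i}) c g) g)"
        using arg_cong[OF star_subsets_sum[OF less.prems(1), of c g], of "\<lambda>h. inner h g"]
        by (simp add: inner_sum_left g(3) r_def)
      also have "\<dots> \<le> (\<Sum>i\<in>S. (real m - 2) * inner g g)"
      proof (rule sum_mono)
        fix i assume i: "i \<in> S"
        have c: "card (S - {i}) = card S - 1" "card S > 0"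
          using i less.prems(1) by (auto simp: card_gt_0_iff)
        show "inner (star (S - {i}) c g) g \<le> (real m - 2) * inner g g"
          using less.prems g(1) c False by (intro less.hyps) auto
      qed
      also have "\<dots> = ((r + 1) * (real m - 2)) * inner g g" by (simp add: r_def)
      finally have "r * k \<le> (r + 1) * (real m - 2)"
        using pos by (simp add: mult.assoc[symmetric])
      \<comment> \<open>Equivalent to \<open>m - 2 < r\<close>, which holds as
        \<open>m \<le> r + 1\<close>.\<close>
      also have "\<dots> < r * (real m - 1)" using r by (simp add: algebra_simps)
      finally show ?thesis using r by simp
    qed
    then show "k \<le> real m - 2"
      using integer_less_imp_le[OF g(4), of "int m - 2"] by simp
  qed
qed

section \<open>Multiplicity bounds\<close>

text \<open>Gram-Schmidt without normalisation, hence the division; a zero vector in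
  \<open>C\<close> contributes 0 because division by zero gives 0.\<close>

lemma orthogonal_split:
  fixes B :: "'v::real_inner set"
  assumes "finite B"
  obtains C where "finite C" "card C \<le> card B" "span C = span B"
    "\<forall>v. \<forall>b\<in>span B. inner (v - (\<Sum>c\<in>C. (inner v c / inner c c) *\<^sub>R c)) b = 0"
proof -
  obtain C where C: "finite C" "card C \<le> card B" "span C = span B" "pairwise orthogonal C"
    using basis_orthogonal[OF assms] by blast
  have "inner (v - (\<Sum>c\<in>C. (inner v c / inner c c) *\<^sub>R c)) b = 0" if "b \<in> C" for v b
  proof -
    have "inner (\<Sum>c\<in>C. (inner v c / inner c c) *\<^sub>R c) b = (\<Sum>c\<in>C. if c = b then inner v b else 0)"
      using C(4) that unfolding inner_sum_left
      by (intro sum.cong refl) (auto simp: pairwise_def orthogonal_def)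
    then show ?thesis using C(1) that by (simp add: inner_diff_left)
  qed
  then have "inner (v - (\<Sum>c\<in>C. (inner v c / inner c c) *\<^sub>R c)) b = 0" if "b \<in> span B" for v b
    using orthogonal_to_span[of b C] that C(3) unfolding orthogonal_def by blast
  then show ?thesis by (intro that[OF C(1-3)]) blast
qed

text \<open>If the \<open>v x\<close> are the rows of the matrix of an orthogonal projection, both sides of \<open>diag\<close> are its
  diagonal entry at \<open>x\<close>, and the sum is its rank.\<close>

lemma trace_le_card:
  assumes "finite X" "finite B"
    and span: "\<And>x. x \<in> X \<Longrightarrow> v x \<in> span B"
    and diag: "\<And>x. x \<in> X \<Longrightarrow> inner (v x) (v x) = coef (v x) x"
  shows "(\<Sum>x\<in>X. inner (v x) (v x)) \<le> real (card B)"
proof -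
  obtain C where C: "finite C" "card C \<le> card B" "span C = span B"
    "\<forall>v. \<forall>b\<in>span B. inner (v - (\<Sum>c\<in>C. (inner v c / inner c c) *\<^sub>R c)) b = 0"
    by (rule orthogonal_split[OF assms(2)])
  have expand: "v x = (\<Sum>c\<in>C. (inner (v x) c / inner c c) *\<^sub>R c)" if "x \<in> X" for x
  proof -
    define r where "r = v x - (\<Sum>c\<in>C. (inner (v x) c / inner c c) *\<^sub>R c)"
    have "r \<in> span B" unfolding r_def C(3)[symmetric]
      using span[OF that] C(3) by (intro span_diff span_sum span_scale) (auto intro: span_base)
    then have "inner r r = 0" unfolding r_def using C(4) by blast
    then show ?thesis by (simp add: r_def)
  qed
  \<comment> \<open>Cauchy-Schwarz in the form ab \<le> (a^2 + b^2) / 2: one of the two sums is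
    again \<open>inner (v x) (v x)\<close>, and half of it cancels.\<close>
  have le: "inner (v x) (v x) \<le> (\<Sum>c\<in>C. (coef c x)\<^sup>2 / inner c c)" if x: "x \<in> X" for x
  proof -
    have "coef (v x) x = (\<Sum>c\<in>C. (inner (v x) c / inner c c) * coef c x)"
      by (subst expand[OF x]) simp
    also have "\<dots> \<le> (\<Sum>c\<in>C. ((inner (v x) c)\<^sup>2 / inner c c + (coef c x)\<^sup>2 / inner c c) / 2)"
    proof (rule sum_mono)
      fix c
      have "0 \<le> (inner (v x) c - coef c x)\<^sup>2 / inner c c" by simp
      also have "\<dots> = (inner (v x) c)\<^sup>2 / inner c c + (coef c x)\<^sup>2 / inner c c
          - 2 * ((inner (v x) c / inner c c) * coef c x)"
        by (simp add: power2_diff add_divide_distrib diff_divide_distrib)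
      finally show "(inner (v x) c / inner c c) * coef c x
          \<le> ((inner (v x) c)\<^sup>2 / inner c c + (coef c x)\<^sup>2 / inner c c) / 2" by (simp add: mult_ac)
    qed
    also have "\<dots> = ((\<Sum>c\<in>C. (inner (v x) c)\<^sup>2 / inner c c) + (\<Sum>c\<in>C. (coef c x)\<^sup>2 / inner c c)) / 2"
      by (simp add: sum.distrib flip: sum_divide_distrib)
    also have "(\<Sum>c\<in>C. (inner (v x) c)\<^sup>2 / inner c c) = inner (v x) (v x)"
      by (subst (3) expand[OF x]) (simp add: inner_sum_right power2_eq_square)
    finally show ?thesis using diag[OF x] by simp
  qed
  have bessel: "(\<Sum>x\<in>X. (coef c x)\<^sup>2 / inner c c) \<le> 1" for c
  proof (cases "c = 0")
    case False
    have "(\<Sum>x\<in>X. (coef c x)\<^sup>2) \<le> (\<Sum>x\<in>X \<union> {x. coef c x \<noteq> 0}. (coef c x)\<^sup>2)"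
      using assms(1) by (intro sum_mono2) auto
    also have "\<dots> = inner c c"
      using assms(1) by (subst inner_fsfun_eq) (auto simp: power2_eq_square)
    finally show ?thesis using False by (simp flip: sum_divide_distrib)
  qed simp
  have "(\<Sum>x\<in>X. inner (v x) (v x)) \<le> (\<Sum>x\<in>X. \<Sum>c\<in>C. (coef c x)\<^sup>2 / inner c c)"
    by (rule sum_mono) (rule le)
  also have "\<dots> = (\<Sum>c\<in>C. \<Sum>x\<in>X. (coef c x)\<^sup>2 / inner c c)" by (rule sum.swap)
  also have "\<dots> \<le> (\<Sum>c\<in>C. 1)" by (rule sum_mono) (rule bessel)
  also have "\<dots> \<le> real (card B)" using C(2) by simp
  finally show ?thesis .
qed

section \<open>Functions supported on the symmetric group, and coset indicators\<close>

definition on_Sym :: "nat \<Rightarrow> (nat \<Rightarrow> nat) fsfun set"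
  where "on_Sym n = {f. \<forall>x. x \<notin> Sym n \<longrightarrow> coef f x = 0}"

lemma subspace_on_Sym: "subspace (on_Sym n)"
  by (auto simp: subspace_def on_Sym_def)

lemma finite_Sym [simp]: "finite (Sym n)"
  by (simp add: Sym_def finite_permutations)

lemma card_Sym: "card (Sym n) = fact n"
  by (simp add: Sym_def card_permutations)

lemma Sym_bij: "x \<in> Sym n \<Longrightarrow> bij x"
  by (auto simp: Sym_def permutes_bij)

lemma Sym_comp: "x \<in> Sym n \<Longrightarrow> y \<in> Sym n \<Longrightarrow> x \<circ> y \<in> Sym n"
  by (auto simp: Sym_def permutes_compose)

lemma Sym_inv: "x \<in> Sym n \<Longrightarrow> inv x \<in> Sym n"
  by (auto simp: Sym_def permutes_inv)

lemma Sym_comp_right_iff: "y \<in> Sym n \<Longrightarrow> x \<circ> y \<in> Sym n \<longleftrightarrow> x \<in> Sym n"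
proof
  assume y: "y \<in> Sym n" "x \<circ> y \<in> Sym n"
  have "(x \<circ> y) \<circ> inv y \<in> Sym n" by (rule Sym_comp[OF y(2) Sym_inv[OF y(1)]])
  moreover have "(x \<circ> y) \<circ> inv y = x"
    using Sym_bij[OF y(1)] by (simp add: fun_eq_iff bij_is_surj surj_f_inv_f)
  ultimately show "x \<in> Sym n" by (simp only:)
qed (rule Sym_comp)

lemma Sym_comp_left_iff: "y \<in> Sym n \<Longrightarrow> y \<circ> x \<in> Sym n \<longleftrightarrow> x \<in> Sym n"
proof
  assume y: "y \<in> Sym n" "y \<circ> x \<in> Sym n"
  have "inv y \<circ> (y \<circ> x) \<in> Sym n" by (rule Sym_comp[OF Sym_inv[OF y(1)] y(2)])
  moreover have "inv y \<circ> (y \<circ> x) = x"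
    using Sym_bij[OF y(1)] by (simp add: fun_eq_iff bij_is_inj)
  ultimately show "x \<in> Sym n" by (simp only:)
qed (rule Sym_comp)

lemma swp_Sym: "i \<in> {1..n} \<Longrightarrow> j \<in> {1..n} \<Longrightarrow> swp i j \<in> Sym n"
  by (auto simp: Sym_def permutes_swap_id)

lemma on_Sym_rtr: "f \<in> on_Sym n \<Longrightarrow> g \<in> Sym n \<Longrightarrow> rtr g f \<in> on_Sym n"
  by (auto simp: on_Sym_def coef_rtr Sym_bij Sym_comp_right_iff)

lemma on_Sym_ltr: "f \<in> on_Sym n \<Longrightarrow> g \<in> Sym n \<Longrightarrow> ltr g f \<in> on_Sym n"
  by (auto simp: on_Sym_def coef_ltr Sym_bij Sym_comp_left_iff)

lemma inner_on_Sym: "f \<in> on_Sym n \<Longrightarrow> inner f g = (\<Sum>x\<in>Sym n. coef f x * coef g x)"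
  by (rule inner_fsfun_eq) (auto simp: on_Sym_def)

text \<open>For \<open>D \<subseteq> {1..n}\<close> and when nonempty, this is a left coset of the
  symmetric group of the complement of \<open>D\<close>; naming it by the values on \<open>D\<close>
  avoids choosing representatives.\<close>

definition coset :: "nat \<Rightarrow> nat set \<Rightarrow> (nat \<Rightarrow> nat) \<Rightarrow> (nat \<Rightarrow> nat) set"
  where "coset n D \<phi> = {y \<in> Sym n. \<forall>a\<in>D. y a = \<phi> a}"

text \<open>Maps \<open>\<phi>\<close> that are not injective only give the empty set, at the price
  of \<open>n ^ j\<close> in the count instead of a falling factorial.\<close>

definition cosets :: "nat \<Rightarrow> nat \<Rightarrow> (nat \<Rightarrow> nat) set set"
  where "cosets n j = (\<lambda>(D, \<phi>). coset n D \<phi>) `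
    (SIGMA D:{D. D \<subseteq> {1..n} \<and> card D = j}. D \<rightarrow>\<^sub>E {1..n})"

lemma finite_cosets: "finite (cosets n j)"
  and card_cosets: "card (cosets n j) \<le> (n choose j) * n ^ j"
proof -
  let ?I = "SIGMA D:{D. D \<subseteq> {1..n} \<and> card D = j}. D \<rightarrow>\<^sub>E {1..n}"
  have fin: "finite {D. D \<subseteq> {1..n} \<and> card D = j}"
    by (rule finite_subset[of _ "Pow {1..n}"]) auto
  have finD: "finite D" if "D \<subseteq> {1..n}" for D :: "nat set"
    using that by (rule finite_subset) simp
  have I: "finite ?I"
    using fin finD by (intro finite_SigmaI finite_PiE) auto
  then show "finite (cosets n j)" by (simp add: cosets_def)
  have "card (cosets n j) \<le> card ?I"
    unfolding cosets_def by (rule card_image_le[OF I])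
  also have "\<dots> = (\<Sum>D | D \<subseteq> {1..n} \<and> card D = j. card (D \<rightarrow>\<^sub>E {1..n}))"
    using fin finD by (intro card_SigmaI) (auto intro: finite_PiE)
  also have "\<dots> = (\<Sum>D | D \<subseteq> {1..n} \<and> card D = j. n ^ j)"
    using finD by (intro sum.cong refl) (auto simp: card_PiE)
  also have "\<dots> = (n choose j) * n ^ j"
    by (simp add: n_subsets)
  finally show "card (cosets n j) \<le> (n choose j) * n ^ j" .
qed

text \<open>At \<open>x\<close> in \<open>Sym n\<close>, \<open>symm A g\<close> is the sum of
  \<open>g\<close> over the left coset of \<open>x\<close> modulo the permutations of
  \<open>A\<close>, that is, over the permutations agreeing with \<open>x\<close> off
  \<open>A\<close>.\<close>

lemma symfree_of_cosets:
  assumes "g \<in> on_Sym n" "m \<le> n" "\<And>C. C \<in> cosets n (n - m) \<Longrightarrow> inner g (indic C) = 0"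
  shows "g \<in> symfree {1..n} m"
proof -
  have "coef (symm A g) x = 0" if A: "A \<subseteq> {1..n}" "card A = m" for A x
  proof -
    have coef: "coef (symm A g) x = (\<Sum>h | h permutes A. coef g (x \<circ> h))"
      by (simp add: symm_def coef_rtr permutes_bij)
    have hSym: "h \<in> Sym n" if "h permutes A" for h
      using permutes_subset[OF that A(1)] by (simp add: Sym_def)
    show ?thesis
    proof (cases "x \<in> Sym n")
      case False
      then have "coef g (x \<circ> h) = 0" if "h permutes A" for h
        using assms(1) Sym_comp_right_iff[OF hSym[OF that]] by (simp add: on_Sym_def)
      then show ?thesis unfolding coef by (intro sum.neutral) simp
    next
      case x: True
      let ?D = "{1..n} - A"
      have fx: "inv x (x z) = z" "x (inv x z) = z" for z
        using Sym_bij[OF x] by (auto simp: bij_is_inj bij_is_surj surj_f_inv_f)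
      have "card ?D = n - m" using A by (simp add: card_Diff_subset finite_subset)
      moreover have "restrict x ?D \<in> ?D \<rightarrow>\<^sub>E {1..n}"
        using x permutes_in_image[of x "{1..n}"] by (auto simp: Sym_def)
      ultimately have "coset n ?D (restrict x ?D) \<in> cosets n (n - m)"
        unfolding cosets_def by (intro image_eqI[where x = "(?D, restrict x ?D)"]) auto
      then have "inner g (indic (coset n ?D (restrict x ?D))) = 0" by (rule assms(3))
      moreover have "(\<Sum>h | h permutes A. coef g (x \<circ> h)) = (\<Sum>y\<in>coset n ?D (restrict x ?D). coef g y)"
      proof (rule sum.reindex_bij_witness[of _ "\<lambda>y. inv x \<circ> y" "\<lambda>h. x \<circ> h"])
        fix h assume h: "h \<in> {h. h permutes A}"
        show "inv x \<circ> (x \<circ> h) = h" by (simp add: fun_eq_iff fx)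
        show "x \<circ> h \<in> coset n ?D (restrict x ?D)"
          using h hSym x by (auto simp: coset_def Sym_comp permutes_not_in)
      next
        fix y assume y: "y \<in> coset n ?D (restrict x ?D)"
        show "x \<circ> (inv x \<circ> y) = y" by (simp add: fun_eq_iff fx)
        have "inv x \<circ> y \<in> Sym n" using x y by (auto simp: coset_def intro!: Sym_comp Sym_inv)
        then have "inv x \<circ> y permutes {1..n}" by (simp add: Sym_def)
        moreover have "(inv x \<circ> y) a = a" if "a \<in> {1..n} - A" for a
          using y that by (simp add: coset_def fx)
        ultimately show "inv x \<circ> y \<in> {h. h permutes A}"
          using permutes_superset by blast
      qed simp
      ultimately show ?thesis by (simp add: coef inner_indic)
    qed
  qed
  then show ?thesis by (auto simp: symfree_def intro!: coef_inject_ext)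
qed

text \<open>Split \<open>f\<close> into eigenvectors within \<open>symfree\<close>: the component
  for \<open>m - 1\<close> vanishes by the bound \<open>m - 2\<close>, and the others are orthogonal
  to \<open>d\<close>.\<close>

lemma eigenvector_orthogonal_symfree:
  assumes m: "1 \<le> m" "m \<le> n" and d: "star {2..n} 1 d = (real m - 1) *\<^sub>R d"
    and f: "f \<in> symfree {1..n} m"
  shows "inner d f = 0"
proof -
  let ?K = "real_of_int ` {- int (card {2..n})..int (card {2..n})}"
  have inv: "star {2..n} 1 g \<in> symfree {1..n} m" if "g \<in> symfree {1..n} m" for g
    using that m by (intro star_in subspace_symfree symfree_rtr) auto
  obtain e where e: "f = (\<Sum>k\<in>?K. e k)"
    "\<And>k. k \<in> ?K \<Longrightarrow> e k \<in> symfree {1..n} m" "\<And>k. k \<in> ?K \<Longrightarrow> star {2..n} 1 (e k) = k *\<^sub>R e k"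
    using eigen_decomposition[OF linear_star _ subspace_symfree inv f
        zpoly_star[of "{2..n}" 1, unfolded zpoly_def]]
    by auto
  have "inner d (e k) = 0" if k: "k \<in> ?K" for k
  proof (cases "k = real m - 1")
    case True
    have "inner (star {2..n} 1 (e k)) (e k) \<le> (real m - 2) * inner (e k) (e k)"
      using e(2)[OF k] m by (intro star_quadratic_symfree[where N = "{1..n}"]) auto
    then have "(k - (real m - 2)) * inner (e k) (e k) \<le> 0"
      by (simp only: e(3)[OF k] inner_scaleR_left left_diff_distrib)
    moreover have "k - (real m - 2) = 1" using True by simp
    ultimately have "inner (e k) (e k) \<le> 0" by (simp only: mult_1_left)
    then have "e k = 0" by (metis inner_eq_zero_iff inner_ge_zero order_antisym)
    then show ?thesis by simp
  next
    case False
    then show ?thesis using eigen_orthogonal[OF inner_star d e(3)[OF k]] by auto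
  qed
  then show ?thesis by (subst e(1)) (simp add: inner_sum_right)
qed

text \<open>The n! left translates of \<open>d\<close> have equal norm and lie in the span of the
  coset indicators, so the trace bound applies. When \<open>d\<close> is the eigencomponent of the
  point mass at \<open>id\<close>, the left side is the multiplicity of
  \<open>m - 1\<close>.\<close>

theorem eigenvector_mass:
  assumes m: "1 \<le> m" "m \<le> n" and d: "star {2..n} 1 d = (real m - 1) *\<^sub>R d"
    and "d \<in> on_Sym n" and mass: "inner d d = coef d id"
  shows "fact n * inner d d \<le> real ((n choose (n - m)) * n ^ (n - m))"
proof -
  let ?B = "indic ` cosets n (n - m)"
  define v where "v x = ltr (inv x) d" for x
  have binv: "bij (inv x)" if "x \<in> Sym n" for x using that by (intro Sym_bij Sym_inv)
  have mass': "inner (v x) (v x) = inner d d" if "x \<in> Sym n" for x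
    using binv[OF that] by (simp add: v_def flip: power2_norm_eq_inner)
  have "(\<Sum>x\<in>Sym n. inner (v x) (v x)) \<le> real (card ?B)"
  proof (rule trace_le_card)
    show "finite (Sym n)" "finite ?B" by (simp_all add: finite_cosets)
  next
    fix x assume x: "x \<in> Sym n"
    have "inv x \<circ> x = id" using Sym_bij[OF x] by (simp add: bij_is_inj inj_iff[THEN iffD1])
    then show "inner (v x) (v x) = coef (v x) x"
      using mass mass'[OF x] by (simp add: v_def coef_ltr binv[OF x])
    have finB: "finite ?B" by (simp add: finite_cosets)
    obtain C where C: "finite C" "card C \<le> card ?B" "span C = span ?B"
      "\<forall>w. \<forall>b\<in>span ?B. inner (w - (\<Sum>c\<in>C. (inner w c / inner c c) *\<^sub>R c)) b = 0"
      by (rule orthogonal_split[OF finB])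
    \<comment> \<open>The projection of \<open>v x\<close> onto the span. The residual has vanishing
      coset sums, so it lies in \<open>symfree\<close>; being orthogonal to \<open>v x\<close> and
      to \<open>p\<close>, it is zero.\<close>
    define p where "p = (\<Sum>c\<in>C. (inner (v x) c / inner c c) *\<^sub>R c)"
    have p: "p \<in> span ?B" unfolding p_def C(3)[symmetric]
      by (intro span_sum span_scale) (auto intro: span_base)
    have "span ?B \<subseteq> on_Sym n"
    proof (rule span_minimal[OF _ subspace_on_Sym])
      show "?B \<subseteq> on_Sym n"
        by (auto simp: on_Sym_def cosets_def coset_def coef_indic)
    qed
    then have on: "v x - p \<in> on_Sym n"
      using p assms(4) x by (intro subspace_diff subspace_on_Sym) (auto simp: v_def on_Sym_ltr Sym_inv)
    have orth: "inner (v x - p) b = 0" if "b \<in> span ?B" for b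
      using C(4) that by (simp add: p_def)
    have "v x - p \<in> symfree {1..n} m"
      using m by (intro symfree_of_cosets[OF on] orth) (auto intro: span_base)
    \<comment> \<open>The residual is translated back to where \<open>d\<close> sits;
      \<open>symfree\<close> is stable under left translation.\<close>
    then have "inner d (ltr (inv (inv x)) (v x - p)) = 0"
      using x by (intro eigenvector_orthogonal_symfree[OF m d] symfree_ltr) (auto intro!: Sym_bij Sym_inv)
    then have "inner (v x) (v x - p) = 0"
      by (simp add: v_def inner_ltr_left binv[OF x])
    moreover have "inner p (v x - p) = 0"
      by (subst inner_commute) (rule orth[OF p])
    ultimately have "inner (v x - p) (v x - p) = 0" by (simp add: inner_diff_left)
    then show "v x \<in> span ?B" using p by simp
  qed
  also have "real (card ?B) \<le> real ((n choose (n - m)) * n ^ (n - m))"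
    using card_image_le[OF finite_cosets[of n "n - m"], of indic] card_cosets[of n "n - m"]
    by (simp only: of_nat_le_iff)
  also have "(\<Sum>x\<in>Sym n. inner (v x) (v x)) = fact n * inner d d"
    by (simp add: mass' card_Sym)
  finally show ?thesis .
qed

section \<open>Twisting by the sign character\<close>

definition twist :: "(nat \<Rightarrow> nat) fsfun \<Rightarrow> (nat \<Rightarrow> nat) fsfun"
  where "twist f = Fs (\<lambda>x. real_of_int (sign x) * coef f x)"

lemma coef_twist: "coef (twist f) x = real_of_int (sign x) * coef f x"
proof -
  have "finite {x. real_of_int (sign x) * coef f x \<noteq> 0}"
    by (rule finite_subset[OF _ finite_support[of f]]) auto
  then show ?thesis by (simp add: twist_def Fs_inverse)
qed

lemma inner_twist: "inner (twist f) (twist f) = inner f f"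
proof -
  have "inner (twist f) (twist f) = (\<Sum>x | coef f x \<noteq> 0. coef (twist f) x * coef (twist f) x)"
    by (rule inner_fsfun_eq) (auto simp: coef_twist)
  also have "\<dots> = inner f f"
    unfolding inner_fsfun_def by (intro sum.cong) (auto simp: coef_twist sign_def)
  finally show ?thesis .
qed

text \<open>Transpositions are odd. Support in \<open>Sym n\<close> confines the multiplicativity of
  \<open>sign\<close> to genuine permutations.\<close>

lemma star_twist:
  assumes "f \<in> on_Sym n" "1 \<le> n"
  shows "star {2..n} 1 (twist f) = - twist (star {2..n} 1 f)"
proof (rule coef_inject_ext)
  fix x
  have "coef (twist f) (x \<circ> swp i 1) = - real_of_int (sign x) * coef f (x \<circ> swp i 1)" if i: "i \<in> {2..n}" for i
  proof (cases "x \<in> Sym n")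
    case True
    then have "permutation x" by (auto simp: Sym_def permutation_permutes)
    then have "sign (x \<circ> swp i 1) = - sign x"
      using i by (simp add: sign_compose permutation_swap_id sign_swap_id)
    then show ?thesis by (simp add: coef_twist)
  next
    case False
    moreover have "swp i 1 \<in> Sym n" using i assms(2) by (intro swp_Sym) auto
    ultimately show ?thesis using assms(1) by (simp add: coef_twist on_Sym_def Sym_comp_right_iff)
  qed
  then show "coef (star {2..n} 1 (twist f)) x = coef (- twist (star {2..n} 1 f)) x"
    by (simp add: star_def coef_rtr coef_twist[of "sum _ _"] sum_distrib_left sum_negf)
qed

lemma on_Sym_twist: "f \<in> on_Sym n \<Longrightarrow> twist f \<in> on_Sym n"
  by (simp add: on_Sym_def coef_twist)

lemma twist_scale: "twist (c *\<^sub>R f) = c *\<^sub>R twist f"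
  by (rule coef_inject_ext) (simp add: coef_twist)

text \<open>\<open>twist d\<close> has the opposite eigenvalue, the same norm, and the same value at
  \<open>id\<close>, where the sign is 1.\<close>

corollary eigenvector_mass_neg:
  assumes m: "1 \<le> m" "m \<le> n" and d: "star {2..n} 1 d = (1 - real m) *\<^sub>R d"
    and "d \<in> on_Sym n" and mass: "inner d d = coef d id"
  shows "fact n * inner d d \<le> real ((n choose (n - m)) * n ^ (n - m))"
proof -
  have "star {2..n} 1 (twist d) = - ((1 - real m) *\<^sub>R twist d)"
    by (simp only: star_twist[OF assms(4) order_trans[OF m]] d twist_scale)
  then have "star {2..n} 1 (twist d) = (real m - 1) *\<^sub>R twist d"
    by (simp only: scaleR_minus_left[symmetric] minus_diff_eq)
  then have "fact n * inner (twist d) (twist d) \<le> real ((n choose (n - m)) * n ^ (n - m))"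
    using assms by (intro eigenvector_mass on_Sym_twist) (auto simp: inner_twist coef_twist)
  then show ?thesis by (simp add: inner_twist)
qed

section \<open>Spectral decomposition of the point mass\<close>

lemma choose_pow_le: "real ((n choose j) * n ^ j) \<le> real n ^ (2 * j) / fact j"
proof -
  have "real (n choose j) * fact j \<le> real n ^ j"
    using binomial_fact_pow[of n j] by (metis of_nat_fact of_nat_le_iff of_nat_mult of_nat_power)
  then have "real (n choose j) * fact j * real n ^ j \<le> real n ^ j * real n ^ j"
    by (rule mult_right_mono) simp
  moreover have "real n ^ (2 * j) = real n ^ j * real n ^ j"
    by (simp add: mult_2 power_add)
  ultimately show ?thesis by (simp add: field_simps)
qed

text \<open>The index \<open>l\<close> is the eigenvalue of \<open>J\<close>, one more than that of
  the star; the star range from \<open>1 - n\<close> to \<open>n - 1\<close> thus becomes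
  \<open>2 - n\<close> to \<open>n\<close>.\<close>

lemma spectral_decomposition:
  assumes "1 \<le> n"
  obtains e :: "int \<Rightarrow> (nat \<Rightarrow> nat) fsfun"
  where "delta id = (\<Sum>l\<in>{2 - int n..int n}. e l)"
    and "\<And>l. l \<in> {2 - int n..int n} \<Longrightarrow> e l \<in> on_Sym n"
    and "\<And>l. l \<in> {2 - int n..int n} \<Longrightarrow> star {2..n} 1 (e l) = (real_of_int l - 1) *\<^sub>R e l"
proof -
  have inv: "star {2..n} 1 g \<in> on_Sym n" if "g \<in> on_Sym n" for g
    using that assms by (intro star_in subspace_on_Sym on_Sym_rtr swp_Sym) auto
  have delta: "delta id \<in> on_Sym n"
    by (auto simp: on_Sym_def delta.rep_eq Sym_def permutes_id)
  obtain d where d: "delta id = (\<Sum>k\<in>real_of_int ` {- int (card {2..n})..int (card {2..n})}. d k)"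
    "\<And>k. k \<in> real_of_int ` {- int (card {2..n})..int (card {2..n})} \<Longrightarrow> d k \<in> on_Sym n"
    "\<And>k. k \<in> real_of_int ` {- int (card {2..n})..int (card {2..n})} \<Longrightarrow> star {2..n} 1 (d k) = k *\<^sub>R d k"
    using eigen_decomposition[OF linear_star _ subspace_on_Sym inv delta
        zpoly_star[of "{2..n}" 1, unfolded zpoly_def]]
    by auto
  have K: "real_of_int ` {- int (card {2..n})..int (card {2..n})} = (\<lambda>l. real_of_int l - 1) ` {2 - int n..int n}"
  proof -
    have "{- int (card {2..n})..int (card {2..n})} = (\<lambda>l. l - 1) ` {2 - int n..int n}"
      using assms by (simp add: of_nat_diff)
    moreover have "(\<lambda>l. real_of_int l - 1) ` {2 - int n..int n} = real_of_int ` (\<lambda>l. l - 1) ` {2 - int n..int n}"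
      by (simp only: image_image of_int_diff of_int_1)
    ultimately show ?thesis by (simp only:)
  qed
  show thesis
  proof (rule that[of "\<lambda>l. d (real_of_int l - 1)"])
    show "delta id = (\<Sum>l\<in>{2 - int n..int n}. d (real_of_int l - 1))"
      unfolding d(1) K by (rule sum.reindex_cong[of "\<lambda>l. real_of_int l - 1"]) (auto simp: inj_on_def)
    fix l assume "l \<in> {2 - int n..int n}"
    then have "real_of_int l - 1 \<in> real_of_int ` {- int (card {2..n})..int (card {2..n})}"
      unfolding K by (rule imageI)
    then show "d (real_of_int l - 1) \<in> on_Sym n"
      "star {2..n} 1 (d (real_of_int l - 1)) = (real_of_int l - 1) *\<^sub>R d (real_of_int l - 1)"
      using d(2,3) by blast+
  qed
qed

section \<open>The walk expressed through the star operator\<close>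

lemma coef_star_sum:
  fixes n :: nat
  assumes "1 \<le> n"
  shows "(\<Sum>j\<in>{1..n}. coef f (x \<circ> swp 1 j)) = coef f x + coef (star {2..n} 1 f) x"
proof -
  have "{1..n} = insert 1 {2..n}" using assms by auto
  then show ?thesis
    by (simp add: star_def coef_rtr transpose_commute[of "Suc 0"])
qed

text \<open>The factor \<open>ttr n (inv y \<circ> x)\<close> is nonzero exactly for the
  \<open>n\<close> distinct elements \<open>y = x \<circ> swp 1 j\<close>.\<close>

lemma conv_ttr:
  assumes "x \<in> Sym n"
  shows "conv n p (ttr n) x = (\<Sum>j\<in>{1..n}. p (x \<circ> swp 1 j)) / real n"
proof -
  let ?y = "\<lambda>j. x \<circ> swp 1 j"
  have xi: "inv x \<circ> x = id" using Sym_bij[OF assms] by (simp add: bij_is_inj)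
  have yS: "?y ` {1..n} \<subseteq> Sym n" using assms by (auto intro!: Sym_comp swp_Sym)
  have inj: "inj_on ?y {1..n}"
  proof (rule inj_onI)
    fix i j assume "?y i = ?y j"
    \<comment> \<open>Evaluation at 1 recovers the index, as (1 i) sends 1 to
      \<open>i\<close>.\<close>
    then have "x (swp 1 i 1) = x (swp 1 j 1)" by (metis comp_apply)
    then show "i = j" using Sym_bij[OF assms] by (simp add: bij_is_inj inj_eq)
  qed
  have val: "ttr n (inv (?y j) \<circ> x) = 1 / real n" if "j \<in> {1..n}" for j
  proof -
    have "inv (?y j) \<circ> x = swp 1 j"
      using Sym_bij[OF assms] xi by (simp add: o_inv_distrib comp_assoc)
    then show ?thesis using that by (auto simp: ttr_def)
  qed
  have zero: "ttr n (inv y \<circ> x) = 0" if y: "y \<in> Sym n - ?y ` {1..n}" for y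
  proof (rule ccontr)
    assume "ttr n (inv y \<circ> x) \<noteq> 0"
    then obtain j where j: "j \<in> {1..n}" "inv y \<circ> x = swp 1 j" by (auto simp: ttr_def split: if_splits)
    have "?y j = y \<circ> (inv y \<circ> x) \<circ> swp 1 j"
      using y Sym_bij[of y n] by (simp add: fun_eq_iff bij_is_surj surj_f_inv_f)
    also have "\<dots> = y" unfolding j(2) by (simp add: fun_eq_iff)
    finally show False using y j(1) by (metis DiffE imageI)
  qed
  have "conv n p (ttr n) x = (\<Sum>y\<in>?y ` {1..n}. p y * ttr n (inv y \<circ> x))"
    unfolding conv_def using yS zero by (intro sum.mono_neutral_right) auto
  also have "\<dots> = (\<Sum>j\<in>{1..n}. p (?y j) * ttr n (inv (?y j) \<circ> x))"
    by (subst sum.reindex[OF inj]) (simp add: o_def)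
  also have "\<dots> = (\<Sum>j\<in>{1..n}. p (?y j)) / real n"
    using val by (simp add: sum_divide_distrib)
  finally show ?thesis .
qed

lemma exp_partial_sum: "(\<Sum>j<N. 1 / fact j) \<le> exp (1::real)"
proof -
  have "(\<lambda>j. 1 / fact j) sums exp (1::real)"
    using exp_converges[of "1::real"] by (simp add: divide_inverse)
  then show ?thesis
    by (metis sum_le_suminf sums_iff finite_lessThan zero_le_divide_1_iff fact_ge_zero)
qed

section \<open>Distance to uniformity in terms of the eigencomponents\<close>

context
  fixes n :: nat and e :: "int \<Rightarrow> (nat \<Rightarrow> nat) fsfun"
  assumes n: "1 \<le> n"
    and e_sum: "delta id = (\<Sum>l\<in>{2 - int n..int n}. e l)"
    and e_on: "\<And>l. l \<in> {2 - int n..int n} \<Longrightarrow> e l \<in> on_Sym n"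
    and e_eig: "\<And>l. l \<in> {2 - int n..int n} \<Longrightarrow> star {2..n} 1 (e l) = (real_of_int l - 1) *\<^sub>R e l"
begin

lemma e_orth:
  assumes "k \<in> {2 - int n..int n}" "l \<in> {2 - int n..int n}"
  shows "inner (e k) (e l) = (if l = k then inner (e k) (e k) else 0)"
  using eigen_orthogonal[OF inner_star e_eig[OF assms(1)] e_eig[OF assms(2)]] by auto

text \<open>By orthogonality, pairing \<open>e l\<close> with the whole point mass
  \<open>delta id\<close> leaves only its own square.\<close>

lemma e_mass:
  assumes "l \<in> {2 - int n..int n}"
  shows "inner (e l) (e l) = coef (e l) id"
proof -
  have "coef (e l) id = (\<Sum>k\<in>{2 - int n..int n}. inner (e l) (e k))"
    by (simp add: e_sum inner_sum_right flip: inner_delta)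
  also have "\<dots> = (\<Sum>k\<in>{2 - int n..int n}. if k = l then inner (e l) (e l) else 0)"
    using assms by (intro sum.cong refl e_orth)
  finally show ?thesis using assms by simp
qed

lemma e_mass_top:
  assumes "j < n"
  shows "fact n * inner (e (int n - int j)) (e (int n - int j)) \<le> real n ^ (2 * j) / fact j"
proof -
  have "fact n * inner (e (int n - int j)) (e (int n - int j))
      \<le> real ((n choose (n - (n - j))) * n ^ (n - (n - j)))"
  proof (intro eigenvector_mass e_on e_mass)
    show "star {2..n} 1 (e (int n - int j)) = (real (n - j) - 1) *\<^sub>R e (int n - int j)"
      using e_eig[of "int n - int j"] assms by (simp add: of_nat_diff del: One_nat_def)
  qed (use assms in auto)
  also have "\<dots> \<le> real n ^ (2 * j) / fact j" using assms choose_pow_le[of n j] by simp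
  finally show ?thesis .
qed

text \<open>\<open>j + 2 - n\<close> is the mirror image \<open>2 - (n - j)\<close> of the top
  eigenvalue \<open>n - j\<close> under the sign twist.\<close>

lemma e_mass_bot:
  assumes "j + 2 \<le> n"
  shows "fact n * inner (e (int j + 2 - int n)) (e (int j + 2 - int n)) \<le> real n ^ (2 * j) / fact j"
proof -
  have "fact n * inner (e (int j + 2 - int n)) (e (int j + 2 - int n))
      \<le> real ((n choose (n - (n - j))) * n ^ (n - (n - j)))"
  proof (intro eigenvector_mass_neg e_on e_mass)
    have "real_of_int (int j + 2 - int n) - 1 = 1 - real (n - j)"
      using assms by (simp add: of_nat_diff)
    then show "star {2..n} 1 (e (int j + 2 - int n)) = (1 - real (n - j)) *\<^sub>R e (int j + 2 - int n)"
      using e_eig[of "int j + 2 - int n"] assms by simp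
  qed (use assms in auto)
  also have "\<dots> \<le> real n ^ (2 * j) / fact j" using assms choose_pow_le[of n j] by simp
  finally show ?thesis .
qed

lemma e_star_sum:
  assumes "l \<in> {2 - int n..int n}"
  shows "(\<Sum>j\<in>{1..n}. coef (e l) (x \<circ> swp 1 j)) = real_of_int l * coef (e l) x"
  by (simp only: coef_star_sum[OF n] e_eig[OF assms]) (simp add: algebra_simps)

text \<open>Each step multiplies the component \<open>e l\<close> by \<open>l / n\<close>.\<close>

lemma conv_pow_ttr:
  "x \<in> Sym n \<Longrightarrow> conv_pow n (ttr n) k x = (\<Sum>l\<in>{2 - int n..int n}. (real_of_int l / real n) ^ k * coef (e l) x)"
proof (induction k arbitrary: x)
  case 0
  have "coef (delta id) x = (\<Sum>l\<in>{2 - int n..int n}. coef (e l) x)" by (simp add: e_sum)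
  then show ?case by (simp add: delta.rep_eq)
next
  case (Suc k)
  have "conv_pow n (ttr n) (Suc k) x
      = (\<Sum>j\<in>{1..n}. \<Sum>l\<in>{2 - int n..int n}. (real_of_int l / real n) ^ k * coef (e l) (x \<circ> swp 1 j)) / real n"
  proof -
    have "x \<circ> swp 1 j \<in> Sym n" if "j \<in> {1..n}" for j
      using Suc.prems that n by (intro Sym_comp swp_Sym) auto
    then show ?thesis
      unfolding conv_pow.simps conv_ttr[OF Suc.prems]
      by (intro arg_cong2[where f = "(/)"] sum.cong refl Suc.IH)
  qed
  also have "\<dots> = (\<Sum>l\<in>{2 - int n..int n}. (real_of_int l / real n) ^ k * (\<Sum>j\<in>{1..n}. coef (e l) (x \<circ> swp 1 j))) / real n"
    by (subst sum.swap) (simp add: sum_distrib_left)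
  also have "\<dots> = (\<Sum>l\<in>{2 - int n..int n}. (real_of_int l / real n) ^ k * (real_of_int l * coef (e l) x)) / real n"
    by (intro arg_cong2[where f = "(/)"] sum.cong refl) (simp only: e_star_sum)
  also have "\<dots> = (\<Sum>l\<in>{2 - int n..int n}. (real_of_int l / real n) ^ Suc k * coef (e l) x)"
    by (simp add: sum_divide_distrib mult_ac)
  finally show ?case .
qed

text \<open>Right translation preserves total mass, so summing the eigenvalue equation gives
  \<open>n * s k = k * s k\<close>; all the mass of \<open>delta id\<close> therefore sits at
  \<open>l = n\<close>.\<close>

lemma e_total:
  assumes l: "l \<in> {2 - int n..int n}"
  shows "(\<Sum>x\<in>Sym n. coef (e l) x) = (if l = int n then 1 else 0)"
proof -
  define s where "s l = (\<Sum>x\<in>Sym n. coef (e l) x)" for l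
  have s0: "s k = 0" if k: "k \<in> {2 - int n..int n}" "k \<noteq> int n" for k
  proof -
    have shift: "(\<Sum>x\<in>Sym n. coef (e k) (x \<circ> swp 1 j)) = s k" if "j \<in> {1..n}" for j
    proof -
      have "swp 1 j \<in> Sym n" using that n by (intro swp_Sym) auto
      then show ?thesis unfolding s_def
        by (intro sum.reindex_bij_witness[of _ "\<lambda>x. x \<circ> swp 1 j" "\<lambda>x. x \<circ> swp 1 j"])
           (auto simp: Sym_comp comp_assoc)
    qed
    have "real n * s k = (\<Sum>j\<in>{1..n}. \<Sum>x\<in>Sym n. coef (e k) (x \<circ> swp 1 j))"
      using shift by simp
    also have "\<dots> = (\<Sum>x\<in>Sym n. \<Sum>j\<in>{1..n}. coef (e k) (x \<circ> swp 1 j))"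
      by (rule sum.swap)
    also have "\<dots> = real_of_int k * s k"
      by (simp only: e_star_sum[OF k(1)] s_def sum_distrib_left)
    finally show ?thesis using k(2) by auto
  qed
  have "1 = (\<Sum>x\<in>Sym n. coef (delta id) x)"
    by (simp add: delta.rep_eq Sym_def permutes_id finite_permutations)
  also have "\<dots> = (\<Sum>k\<in>{2 - int n..int n}. s k)"
    unfolding s_def by (subst sum.swap) (simp add: e_sum)
  also have "\<dots> = (\<Sum>k\<in>{2 - int n..int n}. if k = int n then s (int n) else 0)"
    using s0 by (intro sum.cong) auto
  also have "\<dots> = s (int n)" using n by simp
  finally show ?thesis using s0[OF l] by (auto simp: s_def)
qed

text \<open>Plancherel. \<open>w (int n) = 1\<close> makes the total mass 1, so expanding the square
  about the uniform law subtracts exactly 1.\<close>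

lemma d2_spectral:
  assumes p: "\<And>x. x \<in> Sym n \<Longrightarrow> p x = (\<Sum>l\<in>{2 - int n..int n}. w l * coef (e l) x)" and "w (int n) = 1"
  shows "(d2 n p)\<^sup>2 = (\<Sum>l\<in>{2 - int n..int n}. (w l)\<^sup>2 * (fact n * inner (e l) (e l))) - 1"
proof -
  define P where "P = (\<Sum>l\<in>{2 - int n..int n}. w l *\<^sub>R e l)"
  have P: "P \<in> on_Sym n" unfolding P_def
    using e_on by (intro subspace_sum subspace_scale subspace_on_Sym)
  have "inner P P = (\<Sum>x\<in>Sym n. (p x)\<^sup>2)"
    unfolding inner_on_Sym[OF P] by (intro sum.cong refl) (simp add: P_def p power2_eq_square)
  moreover have "inner P P = (\<Sum>l\<in>{2 - int n..int n}. \<Sum>k\<in>{2 - int n..int n}. w k * (w l * inner (e k) (e l)))"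
    by (simp add: P_def inner_sum_left inner_sum_right sum_distrib_left mult.left_commute)
  moreover have "\<dots> = (\<Sum>l\<in>{2 - int n..int n}. \<Sum>k\<in>{2 - int n..int n}. if l = k then (w k)\<^sup>2 * inner (e k) (e k) else 0)"
    by (intro sum.cong refl, subst e_orth) (auto simp: power2_eq_square)
  ultimately have sq: "(\<Sum>x\<in>Sym n. (p x)\<^sup>2) = (\<Sum>l\<in>{2 - int n..int n}. (w l)\<^sup>2 * inner (e l) (e l))"
    by simp
  have tot: "(\<Sum>x\<in>Sym n. p x) = 1"
  proof -
    have "(\<Sum>x\<in>Sym n. p x) = (\<Sum>l\<in>{2 - int n..int n}. w l * (\<Sum>x\<in>Sym n. coef (e l) x))"
      by (simp add: p sum_distrib_left) (rule sum.swap)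
    also have "\<dots> = (\<Sum>l\<in>{2 - int n..int n}. if l = int n then 1 else 0)"
      using assms(2) by (intro sum.cong refl) (simp add: e_total)
    finally show ?thesis using n by simp
  qed
  have "(d2 n p)\<^sup>2 = fact n * (\<Sum>x\<in>Sym n. (p x - 1 / fact n)\<^sup>2)"
    unfolding d2_def by (subst real_sqrt_pow2) (auto simp: card_Sym intro!: mult_nonneg_nonneg sum_nonneg)
  also have "(\<Sum>x\<in>Sym n. (p x - 1 / fact n)\<^sup>2)
      = (\<Sum>x\<in>Sym n. (p x)\<^sup>2) - 2 / fact n * (\<Sum>x\<in>Sym n. p x) + real (card (Sym n)) * (1 / fact n)\<^sup>2"
    by (simp add: power2_diff sum.distrib sum_subtractf sum_distrib_left sum_divide_distrib algebra_simps)
  also have "fact n * \<dots> = fact n * (\<Sum>x\<in>Sym n. (p x)\<^sup>2) - 1"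
    by (simp add: tot card_Sym power2_eq_square field_simps)
  finally show ?thesis by (simp add: sq sum_distrib_left mult_ac)
qed

text \<open>The weight exponent is \<open>n - \<bar>l\<bar>\<close>; in the squared weight the
  powers of \<open>n\<close> cancel the multiplicity \<open>n ^ (2 * j)\<close>, with a spare factor
  \<open>n ^ 4\<close> at the bottom.\<close>

lemma d2_bound:
  assumes p: "\<And>x. x \<in> Sym n \<Longrightarrow> p x = (\<Sum>l\<in>{2 - int n..int n}. w l * coef (e l) x)"
    and w1: "w (int n) = 1" and c: "c \<ge> 0"
    and top: "\<And>j. j < n \<Longrightarrow> \<bar>w (int n - int j)\<bar> \<le> (exp (- c) / real n) ^ j"
    and bot: "\<And>j. j + 2 \<le> n \<Longrightarrow> \<bar>w (int j + 2 - int n)\<bar> \<le> (exp (- c) / real n) ^ (j + 2)"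
  shows "d2 n p \<le> sqrt 2 * exp (- c)"
proof -
  define z where "z = (exp (- c))\<^sup>2"
  have z: "0 \<le> z" "z \<le> 1" using c by (auto simp: z_def power_le_one)
  define g where "g l = (w l)\<^sup>2 * (fact n * inner (e l) (e l))" for l
  have sq: "a\<^sup>2 \<le> (z / (real n)\<^sup>2) ^ i" if "\<bar>a\<bar> \<le> (exp (- c) / real n) ^ i" for a i
  proof -
    have "\<bar>a\<bar>\<^sup>2 \<le> ((exp (- c) / real n) ^ i)\<^sup>2" using that by (intro power_mono) auto
    then show ?thesis by (simp add: z_def power_divide power_mult[symmetric] mult.commute)
  qed
  have zn: "(z / (real n)\<^sup>2) ^ j * real n ^ (2 * j) = z ^ j" for j
    using n by (simp add: power_divide power_mult)
  have gtop: "g (int n - int j) \<le> z ^ j / fact j" if "j < n" for j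
  proof -
    have "g (int n - int j) \<le> (z / (real n)\<^sup>2) ^ j * (real n ^ (2 * j) / fact j)"
      unfolding g_def using that z by (intro mult_mono sq top e_mass_top) auto
    then show ?thesis using zn[of j] by simp
  qed
  have gbot: "g (int j + 2 - int n) \<le> z / 16 * (1 / fact j)" if "j + 2 \<le> n" for j
  proof -
    have "g (int j + 2 - int n) \<le> (z / (real n)\<^sup>2) ^ (j + 2) * (real n ^ (2 * j) / fact j)"
      unfolding g_def using that z by (intro mult_mono sq bot e_mass_bot) auto
    also have "\<dots> = z ^ (j + 2) / real n ^ 4 * (1 / fact j)"
      using zn[of j] n by (simp add: power_add power2_eq_square field_simps power4_eq_xxxx)
    also have "\<dots> \<le> z / 16 * (1 / fact j)"
    proof (rule mult_right_mono)
      \<comment> \<open>The bottom components occur only for \<open>n \<ge> 2\<close>, whence the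
        16.\<close>
      have "(2::real) ^ 4 \<le> real n ^ 4" using that by (intro power_mono) auto
      moreover have "z ^ (j + 2) \<le> z ^ 1" using z by (intro power_decreasing) auto
      ultimately show "z ^ (j + 2) / real n ^ 4 \<le> z / 16"
        using z by (intro frac_le) auto
    qed simp
    finally show ?thesis .
  qed
  \<comment> \<open>\<open>l = n\<close> cancels the subtracted 1; the other positive
    \<open>l\<close> are written \<open>n - j\<close>, the remaining ones
    \<open>j + 2 - n\<close>.\<close>
  have split: "{2 - int n..int n} = insert (int n) ({1..int n - 1} \<union> {2 - int n..0})" using n by auto
  have "(\<Sum>l\<in>{2 - int n..int n}. g l) = g (int n) + ((\<Sum>l\<in>{1..int n - 1}. g l) + (\<Sum>l\<in>{2 - int n..0}. g l))"
    unfolding split using n by (subst sum.insert) (auto intro!: sum.union_disjoint)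
  also have "(\<Sum>l\<in>{1..int n - 1}. g l) = (\<Sum>j\<in>{1..<n}. g (int n - int j))"
    by (rule sum.reindex_bij_witness[of _ "\<lambda>j. int n - int j" "\<lambda>l. nat (int n - l)"]) auto
  also have "(\<Sum>l\<in>{2 - int n..0}. g l) = (\<Sum>j<n - 1. g (int j + 2 - int n))"
    by (rule sum.reindex_bij_witness[of _ "\<lambda>j. int j + 2 - int n" "\<lambda>l. nat (l + int n - 2)"]) auto
  also have "g (int n) \<le> 1" using gtop[of 0] n by simp
  also have "(\<Sum>j\<in>{1..<n}. g (int n - int j)) \<le> (\<Sum>j\<in>{1..<n}. z * (1 / fact j))"
  proof (rule sum_mono)
    fix j assume j: "j \<in> {1..<n}"
    have "z ^ j \<le> z ^ 1" using z j by (intro power_decreasing) auto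
    then have "z ^ j / fact j \<le> z / fact j" by (intro divide_right_mono) auto
    then show "g (int n - int j) \<le> z * (1 / fact j)" using gtop[of j] j by simp
  qed
  also have "\<dots> = z * ((\<Sum>j<n. 1 / fact j) - 1)"
  proof -
    have "{..<n} = insert 0 {1..<n}" using n by auto
    then show ?thesis by (simp add: sum_distrib_left)
  qed
  also have "\<dots> \<le> z * (exp 1 - 1)"
    using z exp_partial_sum[of n] by (intro mult_left_mono) auto
  also have "(\<Sum>j<n - 1. g (int j + 2 - int n)) \<le> (\<Sum>j<n - 1. z / 16 * (1 / fact j))"
    by (intro sum_mono gbot) auto
  also have "\<dots> \<le> z / 16 * exp 1"
    using z exp_partial_sum[of "n - 1"] by (subst sum_distrib_left[symmetric], intro mult_left_mono) auto
  finally have "(\<Sum>l\<in>{2 - int n..int n}. g l) - 1 \<le> z * (17 / 16 * exp 1 - 1)"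
    by (simp add: algebra_simps)
  \<comment> \<open>From e < 2.72 the factor is below 17/16 times 2.72, minus 1, which is
    1.89.\<close>
  also have "\<dots> \<le> z * 2"
    using z e_less_272 by (intro mult_left_mono) auto
  finally have "(d2 n p)\<^sup>2 \<le> (sqrt 2 * exp (- c))\<^sup>2"
    by (simp add: d2_spectral[OF p w1] g_def z_def power_mult_distrib)
  then show ?thesis by (rule power2_le_imp_le) simp
qed

end

theorem theorem3p1:
  fixes n :: nat and c :: real
  assumes "n \<ge> 1" and "c \<ge> 0"
  shows "(\<forall>t::nat. real t \<ge> real n * (ln (real n) + c) \<longrightarrow>
            d2 n (conv_pow n (ttr n) t) \<le> sqrt 2 * exp (- c))
       \<and> (\<forall>t::real. t \<ge> real n * (ln (real n) + c) \<longrightarrow>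
            d2 n (heat n (ttr n) t) \<le> sqrt 2 * exp (- c))"
proof -
  obtain e :: "int \<Rightarrow> (nat \<Rightarrow> nat) fsfun" where e:
    "delta id = (\<Sum>l\<in>{2 - int n..int n}. e l)"
    "\<And>l. l \<in> {2 - int n..int n} \<Longrightarrow> e l \<in> on_Sym n"
    "\<And>l. l \<in> {2 - int n..int n} \<Longrightarrow> star {2..n} 1 (e l) = (real_of_int l - 1) *\<^sub>R e l"
    using spectral_decomposition[OF assms(1)] by blast
  note bound = d2_bound[OF assms(1) e _ _ assms(2)]
  have n: "real n > 0" using assms(1) by simp
  have decay: "exp (- (real i * s / real n)) \<le> (exp (- c) / real n) ^ i"
    if "real n * (ln (real n) + c) \<le> s" for i s
  proof -
    have "exp (- c) / real n = exp (- (ln (real n) + c))"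
      using n exp_diff[of "- c" "ln (real n)"] by (simp add: algebra_simps)
    then have "(exp (- c) / real n) ^ i = exp (- (real i * (ln (real n) + c)))"
      by (simp add: exp_of_nat_mult[symmetric] algebra_simps)
    moreover have "ln (real n) + c \<le> s / real n" using that n by (simp add: field_simps)
    then have "real i * (ln (real n) + c) \<le> real i * (s / real n)" by (intro mult_left_mono) auto
    ultimately show ?thesis by simp
  qed
  show ?thesis
  proof (intro conjI allI impI)
    fix t :: nat assume t: "real n * (ln (real n) + c) \<le> real t"
    \<comment> \<open>Both ends of the spectrum are covered: \<open>i = j\<close> for
      \<open>l = n - j\<close> and \<open>i = j + 2\<close> for \<open>l = j + 2 - n\<close>. The
      inequality is 1 - x \<le> exp(-x).\<close>
    have pow: "\<bar>(real_of_int l / real n) ^ t\<bar> \<le> (exp (- c) / real n) ^ i"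
      if "\<bar>real_of_int l\<bar> = real n - real i" for l i
    proof -
      have "\<bar>real_of_int l / real n\<bar> = 1 + - (real i / real n)"
        using n that by (simp add: field_simps)
      also have "\<dots> \<le> exp (- (real i / real n))" by (rule exp_ge_add_one_self)
      finally have "\<bar>real_of_int l / real n\<bar> ^ t \<le> exp (- (real i / real n)) ^ t"
        by (intro power_mono) auto
      also have "\<dots> = exp (- (real i * real t / real n))"
        by (simp add: exp_of_nat_mult[symmetric] mult_ac)
      also have "\<dots> \<le> (exp (- c) / real n) ^ i" by (rule decay[OF t])
      finally show ?thesis by (simp add: power_abs)
    qed
    show "d2 n (conv_pow n (ttr n) t) \<le> sqrt 2 * exp (- c)"
    proof (rule bound[where w = "\<lambda>l. (real_of_int l / real n) ^ t"])
      show "conv_pow n (ttr n) t x = (\<Sum>l\<in>{2 - int n..int n}. (real_of_int l / real n) ^ t * coef (e l) x)"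
        if "x \<in> Sym n" for x
        using conv_pow_ttr[OF assms(1) e that] .
      show "(real_of_int (int n) / real n) ^ t = 1" using n by simp
      show "\<bar>(real_of_int (int n - int j) / real n) ^ t\<bar> \<le> (exp (- c) / real n) ^ j" if "j < n" for j
        using that by (intro pow) simp
      show "\<bar>(real_of_int (int j + 2 - int n) / real n) ^ t\<bar> \<le> (exp (- c) / real n) ^ (j + 2)"
        if "j + 2 \<le> n" for j
        using that by (intro pow) simp
    qed
  next
    fix t :: real assume t: "real n * (ln (real n) + c) \<le> t"
    have "0 \<le> real n * (ln (real n) + c)" using assms by simp
    then have t0: "0 \<le> t" using t by simp
    \<comment> \<open>These weights are positive, so an upper bound on \<open>l\<close> itself is
      enough, given \<open>t \<ge> 0\<close>.\<close>
    have weight: "\<bar>exp (t * (real_of_int l / real n) - t)\<bar> \<le> (exp (- c) / real n) ^ i"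
      if "real_of_int l \<le> real n - real i" for l i
    proof -
      have "t * real_of_int l \<le> t * (real n - real i)" using that t0 by (rule mult_left_mono)
      then have "t * real_of_int l / real n \<le> t * (real n - real i) / real n"
        using n by (intro divide_right_mono) auto
      also have "\<dots> = t - real i * t / real n" using n by (simp add: field_simps)
      finally have "t * (real_of_int l / real n) - t \<le> - (real i * t / real n)" by simp
      then have "exp (t * (real_of_int l / real n) - t) \<le> exp (- (real i * t / real n))" by simp
      also have "\<dots> \<le> (exp (- c) / real n) ^ i" by (rule decay[OF t])
      finally show ?thesis by simp
    qed
    show "d2 n (heat n (ttr n) t) \<le> sqrt 2 * exp (- c)"
    proof (rule bound[where w = "\<lambda>l. exp (t * (real_of_int l / real n) - t)"])
      fix x assume x: "x \<in> Sym n"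
      \<comment> \<open>The Poisson mixture of the powers of \<open>l / n\<close> sums to an
        exponential in each component.\<close>
      have "(\<lambda>k. \<Sum>l\<in>{2 - int n..int n}. (t * (real_of_int l / real n)) ^ k /\<^sub>R fact k * coef (e l) x)
          sums (\<Sum>l\<in>{2 - int n..int n}. exp (t * (real_of_int l / real n)) * coef (e l) x)"
        by (intro sums_sum sums_mult2 exp_converges)
      moreover have "t ^ k / fact k * conv_pow n (ttr n) k x
          = (\<Sum>l\<in>{2 - int n..int n}. (t * (real_of_int l / real n)) ^ k /\<^sub>R fact k * coef (e l) x)" for k
        by (subst conv_pow_ttr[OF assms(1) e x])
           (simp_all add: sum_distrib_left power_mult_distrib divide_inverse mult_ac)
      ultimately have "(\<lambda>k. t ^ k / fact k * conv_pow n (ttr n) k x)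
          sums (\<Sum>l\<in>{2 - int n..int n}. exp (t * (real_of_int l / real n)) * coef (e l) x)"
        by simp
      then show "heat n (ttr n) t x
          = (\<Sum>l\<in>{2 - int n..int n}. exp (t * (real_of_int l / real n) - t) * coef (e l) x)"
        by (simp add: heat_def sums_iff sum_distrib_left exp_diff exp_minus divide_inverse mult_ac)
    next
      show "exp (t * (real_of_int (int n) / real n) - t) = 1" using n by simp
      show "\<bar>exp (t * (real_of_int (int n - int j) / real n) - t)\<bar> \<le> (exp (- c) / real n) ^ j" for j
        by (intro weight) simp
      show "\<bar>exp (t * (real_of_int (int j + 2 - int n) / real n) - t)\<bar> \<le> (exp (- c) / real n) ^ (j + 2)"
        if "j + 2 \<le> n" for j
        using that by (intro weight) simp
    qed
  qed
qed

end
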